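(* For every $d$-dimensional Orlicz norm $\|\cdot\|_G$ and every $\varepsilon\in(0,1/2)$, there exists a data structure for ANN over $\|\cdot\|_G$ for $n$-point datasets which achieves approximation $O\!\left(\frac{\log\log d}{\varepsilon^2}\right)$ using space $O(d n^{1+\varepsilon})$ and query time $O(d n^{\varepsilon})$.
   Context: For a non-zero convex function $G:\mathbb{R}_+\to\mathbb{R}_+$ with $G(0)=0$, the Orlicz norm $\|\cdot\|_G$ on $\mathbb{R}^d$ is the norm whose unit ball is $\{x\in\mathbb{R}^d : \sum_{i=1}^d G(|x_i|)\le 1\}$. Approximate Near Neighbor (ANN) with approximation $c>1$ over a norm $\|\cdot\|$: given a dataset $P\subset\mathbb{R}^d$ of $n$ points and a threshold $r>0$, preprocess $P$ so that, given a query $q$ such that some $p\in P$ has $\|p-q\|\le r$, the data structure outputs (with constant probability of success) some $p'\in P$ with $\|p'-q\|\le cr$. *)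

theory Defs
  imports "HOL-Probability.Probability"
begin

section \<open>Orlicz norms\<close>

text \<open>Points of $R^d$ are extensional functions on \<^term>\<open>{..<d}\<close>, because the dimension is
  quantified inside the statement.\<close>

abbreviation points :: "nat \<Rightarrow> (nat \<Rightarrow> real) set" where
  "points d \<equiv> {..<d} \<rightarrow>\<^sub>E UNIV"

text \<open>Only the values of \<open>G\<close> on the nonnegative reals matter.\<close>

definition orlicz_function :: "(real \<Rightarrow> real) \<Rightarrow> bool" where
  "orlicz_function G \<longleftrightarrow>
     convex_on {0..} G \<and> (\<forall>x\<ge>0. 0 \<le> G x) \<and> G 0 = 0 \<and> (\<exists>x\<ge>0. G x \<noteq> 0)"

definition orlicz_ball :: "nat \<Rightarrow> (real \<Rightarrow> real) \<Rightarrow> (nat \<Rightarrow> real) set" where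
  "orlicz_ball d G = {x. (\<Sum>i<d. G \<bar>x i\<bar>) \<le> 1}"

text \<open>The norm with a given unit ball is the Minkowski functional of that ball; the lemmas
  below confirm that it is a norm on $R^d$ and that its unit ball is the prescribed one.\<close>

definition orlicz_norm :: "nat \<Rightarrow> (real \<Rightarrow> real) \<Rightarrow> (nat \<Rightarrow> real) \<Rightarrow> real" where
  "orlicz_norm d G x = Inf {t. 0 < t \<and> (\<lambda>i. x i / t) \<in> orlicz_ball d G}"

lemma orlicz_scale:
  assumes "orlicz_function G" "0 \<le> s" "s \<le> 1" "0 \<le> x"
  shows "G (s * x) \<le> s * G x"
  using assms convex_onD[of "{0..}" G s 0 x] by (auto simp: orlicz_function_def)

lemma orlicz_mono:
  assumes "orlicz_function G" "0 \<le> x" "x \<le> y"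
  shows "G x \<le> G y"
proof (cases "y = 0")
  case False
  then have y: "0 < y" using assms by linarith
  have "G x = G ((x / y) * y)" using y by simp
  also have "\<dots> \<le> (x / y) * G y"
    using assms y by (intro orlicz_scale) auto
  also have "\<dots> \<le> 1 * G y"
    using assms y by (intro mult_right_mono) (auto simp: orlicz_function_def)
  finally show ?thesis by simp
qed (use assms in auto)

lemma orlicz_ball_mono:
  assumes "orlicz_function G" "0 < s" "s \<le> t" "(\<lambda>i. x i / s) \<in> orlicz_ball d G"
  shows "(\<lambda>i. x i / t) \<in> orlicz_ball d G"
proof -
  have "(\<Sum>i<d. G \<bar>x i / t\<bar>) \<le> (\<Sum>i<d. G \<bar>x i / s\<bar>)"
  proof (intro sum_mono orlicz_mono[OF assms(1)])
    fix i
    show "\<bar>x i / t\<bar> \<le> \<bar>x i / s\<bar>"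
      using assms(2,3) by (simp add: abs_divide frac_le)
  qed simp
  then show ?thesis using assms(4) by (simp add: orlicz_ball_def)
qed

lemma orlicz_norm_set_nonempty:
  assumes "orlicz_function G"
  shows "{t. 0 < t \<and> (\<lambda>i. x i / t) \<in> orlicz_ball d G} \<noteq> {}"
proof -
  define t where "t = 1 + (\<Sum>i<d. G \<bar>x i\<bar>)"
  have nn: "0 \<le> (\<Sum>i<d. G \<bar>x i\<bar>)"
    using assms by (intro sum_nonneg) (auto simp: orlicz_function_def)
  then have t: "1 \<le> t" by (simp add: t_def)
  have "(\<Sum>i<d. G \<bar>x i / t\<bar>) \<le> (\<Sum>i<d. (1 / t) * G \<bar>x i\<bar>)"
  proof (intro sum_mono)
    fix i
    show "G \<bar>x i / t\<bar> \<le> (1 / t) * G \<bar>x i\<bar>"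
      using orlicz_scale[OF assms, of "1 / t" "\<bar>x i\<bar>"] t by (simp add: abs_divide)
  qed
  also have "\<dots> = (t - 1) / t" by (simp add: sum_divide_distrib t_def)
  also have "\<dots> \<le> 1" using t by simp
  finally have "t \<in> {t. 0 < t \<and> (\<lambda>i. x i / t) \<in> orlicz_ball d G}"
    using t by (simp add: orlicz_ball_def)
  then show ?thesis by blast
qed

lemma orlicz_norm_nonneg:
  assumes "orlicz_function G"
  shows "0 \<le> orlicz_norm d G x"
  unfolding orlicz_norm_def
  using orlicz_norm_set_nonempty[OF assms] by (intro cInf_greatest) auto

lemma orlicz_norm_le_iff:
  assumes G: "orlicz_function G" and s: "0 < s"
  shows "orlicz_norm d G x \<le> s \<longleftrightarrow> (\<lambda>i. x i / s) \<in> orlicz_ball d G"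
proof
  assume "(\<lambda>i. x i / s) \<in> orlicz_ball d G"
  then show "orlicz_norm d G x \<le> s"
    unfolding orlicz_norm_def using s
    by (intro cInf_lower) (auto intro!: bdd_belowI[of _ 0])
next
  assume le: "orlicz_norm d G x \<le> s"
  have above: "(\<Sum>i<d. G \<bar>x i / t\<bar>) \<le> 1" if "s < t" for t
  proof -
    have "Inf {t. 0 < t \<and> (\<lambda>i. x i / t) \<in> orlicz_ball d G} < t"
      using le that by (simp add: orlicz_norm_def)
    then obtain u where "0 < u" "(\<lambda>i. x i / u) \<in> orlicz_ball d G" "u < t"
      using cInf_lessD[OF orlicz_norm_set_nonempty[OF G]] by blast
    then show ?thesis
      using orlicz_ball_mono[OF G, of u t x d] by (simp add: orlicz_ball_def)
  qed
  have cont: "continuous_on {0<..} G"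
  proof (rule convex_on_continuous)
    have "convex_on {0..} G" using G by (simp add: orlicz_function_def)
    then show "convex_on {0<..} G"
      by (rule convex_on_subset) (auto intro: convex_real_interval)
  qed simp
  have lim: "((\<lambda>t. G \<bar>x i / t\<bar>) \<longlongrightarrow> G \<bar>x i / s\<bar>) (at_right s)" for i
  proof (cases "x i = 0")
    case False
    then have "0 < \<bar>x i / s\<bar>" using s by simp
    then have "isCont G \<bar>x i / s\<bar>"
      using cont continuous_on_eq_continuous_at[of "{0<..}" G] by auto
    moreover have "((\<lambda>t. \<bar>x i / t\<bar>) \<longlongrightarrow> \<bar>x i / s\<bar>) (at_right s)"
      using s by (intro tendsto_intros) auto
    ultimately show ?thesis by (rule isCont_tendsto_compose)
  qed simp
  have "((\<lambda>t. \<Sum>i<d. G \<bar>x i / t\<bar>) \<longlongrightarrow> (\<Sum>i<d. G \<bar>x i / s\<bar>)) (at_right s)"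
    by (intro tendsto_sum lim)
  then have "(\<Sum>i<d. G \<bar>x i / s\<bar>) \<le> 1"
    by (rule tendsto_upperbound)
      (use above in \<open>auto simp: eventually_at_right_field intro: exI[of _ "s + 1"]\<close>)
  then show "(\<lambda>i. x i / s) \<in> orlicz_ball d G" by (simp add: orlicz_ball_def)
qed

lemma orlicz_norm_unit_ball:
  assumes "orlicz_function G"
  shows "{x. orlicz_norm d G x \<le> 1} = {x. (\<Sum>i<d. G \<bar>x i\<bar>) \<le> 1}"
  using orlicz_norm_le_iff[OF assms, of 1 d] by (auto simp: orlicz_ball_def)

lemma orlicz_norm_eq_0_iff:
  assumes G: "orlicz_function G"
  shows "orlicz_norm d G x = 0 \<longleftrightarrow> (\<forall>i<d. x i = 0)"
proof
  assume "\<forall>i<d. x i = 0"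
  then have "orlicz_norm d G x \<le> e" if "0 < e" for e
    using G that by (subst orlicz_norm_le_iff[OF G])
      (auto simp: orlicz_ball_def orlicz_function_def)
  then have "orlicz_norm d G x \<le> 0" by (meson dense not_le)
  then show "orlicz_norm d G x = 0" using orlicz_norm_nonneg[OF G, of d x] by simp
next
  assume 0: "orlicz_norm d G x = 0"
  obtain z where z: "0 < z" "0 < G z"
    using G unfolding orlicz_function_def by (metis order_le_less)
  show "\<forall>i<d. x i = 0"
  proof (intro allI impI, rule ccontr)
    fix i assume i: "i < d" "x i \<noteq> 0"
    define m where "m = 1 + 1 / G z"
    have m: "1 < m" "m * G z > 1" using z by (auto simp: m_def field_simps)
    define t where "t = \<bar>x i\<bar> / (m * z)"
    have t: "0 < t" using i m z by (simp add: t_def)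
    have "orlicz_norm d G x \<le> t" using 0 t by simp
    then have "(\<Sum>j<d. G \<bar>x j / t\<bar>) \<le> 1"
      using orlicz_norm_le_iff[OF G t] by (simp add: orlicz_ball_def)
    moreover have "G \<bar>x i / t\<bar> \<le> (\<Sum>j<d. G \<bar>x j / t\<bar>)"
      using G i by (intro member_le_sum) (auto simp: orlicz_function_def)
    moreover have "\<bar>x i / t\<bar> = m * z"
      using i m z by (simp add: t_def abs_divide abs_mult)
    moreover have "G z \<le> (1 / m) * G (m * z)"
      using orlicz_scale[OF G, of "1 / m" "m * z"] m z by simp
    then have "m * G z \<le> G (m * z)"
      using m by (simp add: field_simps)
    ultimately show False using m by simp
  qed
qed

lemma orlicz_norm_scale:
  assumes G: "orlicz_function G"
  shows "orlicz_norm d G (\<lambda>i. a * x i) = \<bar>a\<bar> * orlicz_norm d G x"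
proof (cases "a = 0")
  case True
  then show ?thesis using orlicz_norm_eq_0_iff[OF G, of d "\<lambda>_. 0"] by simp
next
  case False
  have iff: "orlicz_norm d G (\<lambda>i. a * x i) \<le> s \<longleftrightarrow> \<bar>a\<bar> * orlicz_norm d G x \<le> s"
    if s: "0 < s" for s
  proof -
    have "orlicz_norm d G (\<lambda>i. a * x i) \<le> s \<longleftrightarrow> orlicz_norm d G x \<le> s / \<bar>a\<bar>"
      using False s orlicz_norm_le_iff[OF G, of s d] orlicz_norm_le_iff[OF G, of "s / \<bar>a\<bar>" d]
      by (simp add: orlicz_ball_def abs_mult abs_divide mult.commute)
    then show ?thesis using False by (simp add: field_simps)
  qed
  show ?thesis
  proof (rule antisym; rule field_le_epsilon)
    fix e :: real assume e: "0 < e"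
    have n: "0 \<le> \<bar>a\<bar> * orlicz_norm d G x" "0 \<le> orlicz_norm d G (\<lambda>i. a * x i)"
      using orlicz_norm_nonneg[OF G] by auto
    show "orlicz_norm d G (\<lambda>i. a * x i) \<le> \<bar>a\<bar> * orlicz_norm d G x + e"
      using n e by (subst iff) auto
    show "\<bar>a\<bar> * orlicz_norm d G x \<le> orlicz_norm d G (\<lambda>i. a * x i) + e"
      using n e by (subst iff[symmetric]) auto
  qed
qed

lemma orlicz_norm_triangle:
  assumes G: "orlicz_function G"
  shows "orlicz_norm d G (\<lambda>i. x i + y i) \<le> orlicz_norm d G x + orlicz_norm d G y"
proof (rule field_le_epsilon)
  fix e :: real assume e: "0 < e"
  define a where "a = orlicz_norm d G x + e / 2"
  define b where "b = orlicz_norm d G y + e / 2"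
  have ab: "0 < a" "0 < b"
    using e orlicz_norm_nonneg[OF G, of d x] orlicz_norm_nonneg[OF G, of d y]
    by (auto simp: a_def b_def)
  have sx: "(\<Sum>i<d. G \<bar>x i / a\<bar>) \<le> 1"
    using orlicz_norm_le_iff[OF G ab(1), of d x] e by (simp add: a_def orlicz_ball_def)
  have sy: "(\<Sum>i<d. G \<bar>y i / b\<bar>) \<le> 1"
    using orlicz_norm_le_iff[OF G ab(2), of d y] e by (simp add: b_def orlicz_ball_def)
  define u where "u = b / (a + b)"
  have u: "0 \<le> u" "u \<le> 1" "1 - u = a / (a + b)"
    using ab by (auto simp: u_def field_simps)
  have conv: "convex_on {0..} G" using G by (simp add: orlicz_function_def)
  have pt: "G \<bar>(x i + y i) / (a + b)\<bar> \<le> (1 - u) * G \<bar>x i / a\<bar> + u * G \<bar>y i / b\<bar>" for i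
  proof -
    have "\<bar>(x i + y i) / (a + b)\<bar> \<le> (1 - u) * \<bar>x i / a\<bar> + u * \<bar>y i / b\<bar>"
    proof -
      have "(1 - u) * \<bar>x i / a\<bar> + u * \<bar>y i / b\<bar> = (\<bar>x i\<bar> + \<bar>y i\<bar>) / (a + b)"
        using ab unfolding u(3) by (simp add: u_def abs_divide add_divide_distrib)
      moreover have "\<bar>(x i + y i) / (a + b)\<bar> \<le> (\<bar>x i\<bar> + \<bar>y i\<bar>) / (a + b)"
        using ab by (simp add: abs_divide divide_right_mono)
      ultimately show ?thesis by simp
    qed
    then have "G \<bar>(x i + y i) / (a + b)\<bar> \<le> G ((1 - u) * \<bar>x i / a\<bar> + u * \<bar>y i / b\<bar>)"
      by (intro orlicz_mono[OF G]) auto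
    also have "\<dots> \<le> (1 - u) * G \<bar>x i / a\<bar> + u * G \<bar>y i / b\<bar>"
      using convex_onD[OF conv u(1,2), of "\<bar>x i / a\<bar>" "\<bar>y i / b\<bar>"]
      by (simp only: atLeast_iff abs_ge_zero real_scaleR_def)
    finally show ?thesis .
  qed
  have "(\<Sum>i<d. G \<bar>(x i + y i) / (a + b)\<bar>)
      \<le> (1 - u) * (\<Sum>i<d. G \<bar>x i / a\<bar>) + u * (\<Sum>i<d. G \<bar>y i / b\<bar>)"
    using pt by (simp add: sum_distrib_left sum.distrib[symmetric] sum_mono)
  also have "\<dots> \<le> (1 - u) * 1 + u * 1"
    using u sx sy by (intro add_mono mult_left_mono) auto
  finally have "orlicz_norm d G (\<lambda>i. x i + y i) \<le> a + b"
    using orlicz_norm_le_iff[OF G, of "a + b" d "\<lambda>i. x i + y i"] ab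
    by (simp add: orlicz_ball_def)
  then show "orlicz_norm d G (\<lambda>i. x i + y i)
      \<le> orlicz_norm d G x + orlicz_norm d G y + e"
    by (simp add: a_def b_def)
qed


section \<open>The real RAM\<close>

text \<open>Queries are answered by a real RAM: registers and memory cells come in two sorts, machine
  words of a fixed number of bits and exact real numbers. Every instruction takes unit time.
  Addresses are words, and control flow is the only way from reals to words (there is no
  rounding), so a real cell cannot be unpacked in unit time.\<close>

datatype instr =
    WConst nat nat
  | WAdd nat nat nat | WSub nat nat nat | WMul nat nat nat | WDiv nat nat nat
  | WLoad nat nat | WStore nat nat
  | RConst nat rat
  | RAdd nat nat nat | RSub nat nat nat | RMul nat nat nat | RDiv nat nat nat
  | RLoad nat nat | RStore nat nat
  | RInput nat nat
  | WJump nat nat nat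
  | RJump nat nat nat
  | Halt nat

type_synonym memory = "nat list \<times> real list"

record config =
  pc :: nat
  wreg :: "nat \<Rightarrow> nat"
  rreg :: "nat \<Rightarrow> real"
  wmem :: "nat list"
  rmem :: "real list"

definition set_wreg :: "nat \<Rightarrow> nat \<Rightarrow> config \<Rightarrow> config" where
  "set_wreg a v s = s\<lparr>pc := pc s + 1, wreg := (wreg s)(a := v)\<rparr>"

definition set_rreg :: "nat \<Rightarrow> real \<Rightarrow> config \<Rightarrow> config" where
  "set_rreg a v s = s\<lparr>pc := pc s + 1, rreg := (rreg s)(a := v)\<rparr>"

text \<open>\<open>exec b d q\<close> executes one instruction with \<open>b\<close>-bit words on the query
  $q \in R^d$. The result is \<^const>\<open>None\<close> at \<^const>\<open>Halt\<close> and when an address is out of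
  range. \<open>WSub\<close> truncates at 0, so words always stay below \<open>2 ^ b\<close>.\<close>

primrec exec :: "nat \<Rightarrow> nat \<Rightarrow> (nat \<Rightarrow> real) \<Rightarrow> instr \<Rightarrow> config \<Rightarrow> config option" where
  "exec b d q (WConst a k) s = Some (set_wreg a (k mod 2 ^ b) s)"
| "exec b d q (WAdd a x y) s = Some (set_wreg a ((wreg s x + wreg s y) mod 2 ^ b) s)"
| "exec b d q (WSub a x y) s = Some (set_wreg a (wreg s x - wreg s y) s)"
| "exec b d q (WMul a x y) s = Some (set_wreg a ((wreg s x * wreg s y) mod 2 ^ b) s)"
| "exec b d q (WDiv a x y) s = Some (set_wreg a (wreg s x div wreg s y) s)"
| "exec b d q (WLoad a x) s =
     (if wreg s x < length (wmem s) then Some (set_wreg a (wmem s ! wreg s x) s) else None)"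
| "exec b d q (WStore a x) s =
     (if wreg s a < length (wmem s)
      then Some (s\<lparr>pc := pc s + 1, wmem := (wmem s)[wreg s a := wreg s x]\<rparr>) else None)"
| "exec b d q (RConst a k) s = Some (set_rreg a (of_rat k) s)"
| "exec b d q (RAdd a x y) s = Some (set_rreg a (rreg s x + rreg s y) s)"
| "exec b d q (RSub a x y) s = Some (set_rreg a (rreg s x - rreg s y) s)"
| "exec b d q (RMul a x y) s = Some (set_rreg a (rreg s x * rreg s y) s)"
| "exec b d q (RDiv a x y) s = Some (set_rreg a (rreg s x / rreg s y) s)"
| "exec b d q (RLoad a x) s =
     (if wreg s x < length (rmem s) then Some (set_rreg a (rmem s ! wreg s x) s) else None)"
| "exec b d q (RStore a x) s =
     (if wreg s a < length (rmem s)
      then Some (s\<lparr>pc := pc s + 1, rmem := (rmem s)[wreg s a := rreg s x]\<rparr>) else None)"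
| "exec b d q (RInput a x) s =
     (if wreg s x < d then Some (set_rreg a (q (wreg s x)) s) else None)"
| "exec b d q (WJump x y l) s =
     Some (s\<lparr>pc := if wreg s x < wreg s y then l else pc s + 1\<rparr>)"
| "exec b d q (RJump x y l) s =
     Some (s\<lparr>pc := if rreg s x < rreg s y then l else pc s + 1\<rparr>)"
| "exec b d q (Halt a) s = None"

definition step :: "instr list \<Rightarrow> nat \<Rightarrow> nat \<Rightarrow> (nat \<Rightarrow> real) \<Rightarrow> config \<Rightarrow> config option" where
  "step prog b d q s = (if pc s < length prog then exec b d q (prog ! pc s) s else None)"

primrec steps ::
  "instr list \<Rightarrow> nat \<Rightarrow> nat \<Rightarrow> (nat \<Rightarrow> real) \<Rightarrow> nat \<Rightarrow> config \<Rightarrow> config option" where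
  "steps prog b d q 0 s = Some s"
| "steps prog b d q (Suc t) s = Option.bind (step prog b d q s) (steps prog b d q t)"

definition initial :: "memory \<Rightarrow> config" where
  "initial m = \<lparr>pc = 0, wreg = (\<lambda>_. 0), rreg = (\<lambda>_. 0), wmem = fst m, rmem = snd m\<rparr>"

text \<open>\<open>answers prog b d m q t p\<close>: started on memory \<open>m\<close> and query \<open>q\<close>, the program halts after
  \<open>t\<close> instructions with output \<open>p\<close>. The operand of \<^const>\<open>Halt\<close> is a word register
  pointing to \<open>d\<close> consecutive real cells that hold the output point.\<close>

definition answers ::
  "instr list \<Rightarrow> nat \<Rightarrow> nat \<Rightarrow> memory \<Rightarrow> (nat \<Rightarrow> real) \<Rightarrow> nat \<Rightarrow> (nat \<Rightarrow> real) \<Rightarrow> bool" where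
  "answers prog b d m q t p \<longleftrightarrow>
     (\<exists>s a. steps prog b d q t (initial m) = Some s \<and>
        pc s < length prog \<and> prog ! pc s = Halt a \<and>
        wreg s a + d \<le> length (rmem s) \<and>
        p = (\<lambda>i\<in>{..<d}. rmem s ! (wreg s a + i)))"


section \<open>Data structures for approximate near neighbor search\<close>

text \<open>The randomness of the preprocessing: independent uniform samples from the unit interval.\<close>

definition seeds :: "(nat \<Rightarrow> real) measure" where
  "seeds = (\<Pi>\<^sub>M i\<in>UNIV. uniform_measure lborel {0..1})"

text \<open>A data structure consists of a query program \<open>prog\<close> and a preprocessing \<open>pre\<close>, which maps
  a dataset, a threshold and a random seed to the memory on which queries are run. Space counts
  all memory cells of both sorts, including any scratch cells used by queries, and the program
  (hence, up to a constant factor, the registers). The space and time bounds hold for every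
  seed. The success event is only required to contain a measurable event of probability
  \<open>2/3\<close>, since preprocessing may depend on the seed in a non-measurable way.\<close>

definition ann_data_structure ::
  "nat \<Rightarrow> ((nat \<Rightarrow> real) \<Rightarrow> real) \<Rightarrow> real \<Rightarrow> nat \<Rightarrow> instr list \<Rightarrow>
   ((nat \<Rightarrow> real) set \<Rightarrow> real \<Rightarrow> (nat \<Rightarrow> real) \<Rightarrow> memory) \<Rightarrow> nat \<Rightarrow> real \<Rightarrow> real \<Rightarrow> bool" where
  "ann_data_structure d N c n prog pre b space_bound time_bound \<longleftrightarrow>
     (\<forall>P r. P \<subseteq> points d \<and> finite P \<and> card P = n \<and> 0 < r \<longrightarrow>
        (\<forall>\<omega> \<in> space seeds.
           real (length (fst (pre P r \<omega>)) + length (snd (pre P r \<omega>)) + length prog)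
             \<le> space_bound \<and>
           (\<forall>v \<in> set (fst (pre P r \<omega>)). v < 2 ^ b) \<and>
           (\<forall>q \<in> points d. \<exists>t p. real t \<le> time_bound \<and> answers prog b d (pre P r \<omega>) q t p)) \<and>
        (\<forall>q \<in> points d. (\<exists>p\<in>P. N (\<lambda>i. p i - q i) \<le> r) \<longrightarrow>
           (\<exists>A \<in> sets seeds. 2 / 3 \<le> measure seeds A \<and>
              (\<forall>\<omega>\<in>A. \<exists>t. \<exists>p'\<in>P. real t \<le> time_bound \<and>
                 answers prog b d (pre P r \<omega>) q t p' \<and> N (\<lambda>i. p' i - q i) \<le> c * r))))"

end

theory Submission
  imports Defs
begin

text \<open>Let \<open>w\<^sub>0, \<dots>, w\<^sub>d\<^sub>-\<^sub>1\<close> be independent with \<open>Pr[w\<^sub>i \<ge> t] = exp (- \<lambda> G t)\<close>. Then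
  \<open>\<bar>x\<^sub>i\<bar> \<le> w\<^sub>i\<close> holds for all \<open>i\<close> with probability \<open>exp (- \<lambda> \<Sum>\<^sub>i G \<bar>x\<^sub>i\<bar>)\<close>, which is at least
  \<open>exp (- \<lambda>)\<close> if \<open>x\<close> has Orlicz norm at most 1 and, by convexity, at most \<open>exp (- \<lambda> \<kappa>)\<close> if its
  norm exceeds \<open>\<kappa>\<close>. With \<open>exp \<lambda> = (18 n) powr (\<epsilon> / 2)\<close> and \<open>\<kappa> = 1 + 2 / \<epsilon>\<close>, among \<open>2 exp \<lambda>\<close>
  independent samples some \<open>w\<close> captures the near point, and none captures a far point, with
  probability \<open>2 / 3\<close>.

  Each sample leaves a near neighbour problem for the maximum norm weighted by \<open>w\<close>, which Indyk's
  decision tree solves with approximation \<open>O(log log d / \<epsilon>)\<close>. Moving away from the median of a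
  coordinate in steps of two widths, either some step is a good place to split the point set,
  duplicating the points near the cut, or the fraction of points beyond falls doubly
  exponentially. If no coordinate can be split, at least half of the points lie in a box with
  sides of \<open>O(log log d / \<epsilon>)\<close> widths, and any one of them answers all queries near the box.\<close>

section \<open>Search structures on the real RAM\<close>

datatype search = Fail | Found nat | Cmp nat real search search | Orelse search search

primrec eval :: "(nat \<Rightarrow> real) \<Rightarrow> search \<Rightarrow> nat option" where
  "eval q Fail = None"
| "eval q (Found j) = Some j"
| "eval q (Cmp i t A B) = (if q i < t then eval q A else eval q B)"
| "eval q (Orelse A B) = (case eval q A of None \<Rightarrow> eval q B | Some j \<Rightarrow> Some j)"

text \<open>A bound on the number of jumps made by the compiled code. \<open>Fail\<close> costs 1
  because it becomes a branch both of whose targets are the continuation; \<open>Found\<close> costs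
  0 because an output node ends the walk. \<open>Orelse\<close> is charged for both parts even if
  the first one succeeds.\<close>

primrec cost :: "(nat \<Rightarrow> real) \<Rightarrow> search \<Rightarrow> nat" where
  "cost q Fail = 1"
| "cost q (Found j) = 0"
| "cost q (Cmp i t A B) = Suc (if q i < t then cost q A else cost q B)"
| "cost q (Orelse A B) = cost q A + cost q B"

primrec nodes :: "search \<Rightarrow> nat" where
  "nodes Fail = 1"
| "nodes (Found j) = 1"
| "nodes (Cmp i t A B) = Suc (nodes A + nodes B)"
| "nodes (Orelse A B) = nodes A + nodes B"

primrec wf_search :: "nat \<Rightarrow> nat \<Rightarrow> search \<Rightarrow> bool" where
  "wf_search d n Fail = True"
| "wf_search d n (Found j) = (j < n)"
| "wf_search d n (Cmp i t A B) = (i < d \<and> wf_search d n A \<and> wf_search d n B)"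
| "wf_search d n (Orelse A B) = (wf_search d n A \<and> wf_search d n B)"

datatype node = Branch nat real nat nat | Output nat

text \<open>\<open>compile base k S\<close> is the code of \<open>S\<close> placed at address \<open>base\<close>; a failed search continues
  at address \<open>k\<close>. Sharing \<open>k\<close> between all failures of \<open>S\<close> is what keeps the code of
  \<^const>\<open>Orelse\<close> additive in size.\<close>

primrec compile :: "nat \<Rightarrow> nat \<Rightarrow> search \<Rightarrow> node list" where
  "compile base k Fail = [Branch 0 0 k k]"
| "compile base k (Found j) = [Output j]"
| "compile base k (Cmp i t A B) =
     Branch i t (Suc base) (Suc (base + nodes A)) #
     compile (Suc base) k A @ compile (Suc (base + nodes A)) k B"
| "compile base k (Orelse A B) =
     compile base (base + nodes A) A @ compile (base + nodes A) k B"

lemma nodes_pos: "0 < nodes S"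
  by (induction S) auto

lemma length_compile [simp]: "length (compile base k S) = nodes S"
  by (induction S arbitrary: base k) auto

text \<open>An output node is a fixed point, so iterating beyond the end of a search keeps its
  answer.\<close>

definition follow :: "node list \<Rightarrow> (nat \<Rightarrow> real) \<Rightarrow> nat \<Rightarrow> nat" where
  "follow C q a = (case C ! a of Branch i t l g \<Rightarrow> if q i < t then l else g | Output j \<Rightarrow> a)"

text \<open>The context \<open>xs\<close>, \<open>ys\<close> lets the induction reach the fragments
  of subtrees, which lie at shifted addresses inside one fixed code \<open>C\<close>.\<close>

lemma follow_compile:
  assumes "C = xs @ compile base k S @ ys" "length xs = base"
  shows "\<exists>m\<le>cost q S. case eval q S of
           None \<Rightarrow> (follow C q ^^ m) base = k
         | Some j \<Rightarrow> C ! ((follow C q ^^ m) base) = Output j"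
  using assms
proof (induction S arbitrary: base k xs ys)
  case Fail
  then have "C ! base = Branch 0 0 k k" by (auto simp: nth_append)
  then show ?case by (intro exI[of _ 1]) (simp add: follow_def)
next
  case (Found j)
  then have "C ! base = Output j" by (auto simp: nth_append)
  then show ?case by (intro exI[of _ 0]) simp
next
  case (Cmp i t A B)
  have C: "C ! base = Branch i t (Suc base) (Suc (base + nodes A))"
    using Cmp.prems by (auto simp: nth_append)
  obtain m where m: "m \<le> cost q A" "case eval q A of
       None \<Rightarrow> (follow C q ^^ m) (Suc base) = k
     | Some j \<Rightarrow> C ! ((follow C q ^^ m) (Suc base)) = Output j"
    using Cmp.IH(1)[of "xs @ [C ! base]" "Suc base" k "compile (Suc (base + nodes A)) k B @ ys"]
      Cmp.prems C by auto
  obtain m' where m': "m' \<le> cost q B" "case eval q B of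
       None \<Rightarrow> (follow C q ^^ m') (Suc (base + nodes A)) = k
     | Some j \<Rightarrow> C ! ((follow C q ^^ m') (Suc (base + nodes A))) = Output j"
    using Cmp.IH(2)[of "xs @ [C ! base] @ compile (Suc base) k A" "Suc (base + nodes A)" k ys]
      Cmp.prems C by auto
  show ?case
  proof (cases "q i < t")
    case True
    then have "follow C q base = Suc base" by (simp add: follow_def C)
    then show ?thesis using m True
      by (intro exI[of _ "Suc m"]) (simp add: funpow_swap1 split: option.splits)
  next
    case False
    then have "follow C q base = Suc (base + nodes A)" by (simp add: follow_def C)
    then show ?thesis using m' False
      by (intro exI[of _ "Suc m'"]) (simp add: funpow_swap1 split: option.splits)
  qed
next
  case (Orelse A B)
  obtain m where m: "m \<le> cost q A" "case eval q A of
       None \<Rightarrow> (follow C q ^^ m) base = base + nodes A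
     | Some j \<Rightarrow> C ! ((follow C q ^^ m) base) = Output j"
    using Orelse.IH(1)[of xs base "base + nodes A" "compile (base + nodes A) k B @ ys"]
      Orelse.prems by auto
  obtain m' where m': "m' \<le> cost q B" "case eval q B of
       None \<Rightarrow> (follow C q ^^ m') (base + nodes A) = k
     | Some j \<Rightarrow> C ! ((follow C q ^^ m') (base + nodes A)) = Output j"
    using Orelse.IH(2)[of "xs @ compile base (base + nodes A) A" "base + nodes A" k ys]
      Orelse.prems by auto
  show ?case
  proof (cases "eval q A")
    case None
    \<comment> \<open>Of the \<open>m' + m\<close> jumps, the \<open>m\<close> through
      \<open>A\<close> come first and end at the first node of \<open>B\<close>.\<close>
    then show ?thesis using m m'
      by (intro exI[of _ "m' + m"]) (simp add: funpow_add split: option.splits)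
  next
    case (Some j)
    then show ?thesis using m by (intro exI[of _ m]) simp
  qed
qed

definition node_ok :: "nat \<Rightarrow> nat \<Rightarrow> nat \<Rightarrow> node \<Rightarrow> bool" where
  "node_ok d n N x = (case x of Branch i t l g \<Rightarrow> i < d \<and> l < N \<and> g < N | Output j \<Rightarrow> j < n)"

text \<open>\<open>Fail\<close> compares coordinate 0, hence \<open>0 < d\<close>. In
  \<open>Orelse\<close> the continuation of the first part is a valid address because the second
  part has at least one node.\<close>

lemma node_ok_compile:
  assumes "wf_search d n S" "base + nodes S \<le> N" "k < N" "0 < d" "x \<in> set (compile base k S)"
  shows "node_ok d n N x"
  using assms
proof (induction S arbitrary: base k)
  case (Cmp i t A B)
  from Cmp.prems consider "x = Branch i t (Suc base) (Suc (base + nodes A))"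
    | "x \<in> set (compile (Suc base) k A)" | "x \<in> set (compile (Suc (base + nodes A)) k B)"
    by auto
  then show ?case
  proof cases
    case 1
    then show ?thesis using Cmp.prems nodes_pos[of B] by (simp add: node_ok_def)
  next
    case 2
    then show ?thesis using Cmp.prems by (intro Cmp.IH(1)[of "Suc base" k]) auto
  next
    case 3
    then show ?thesis using Cmp.prems by (intro Cmp.IH(2)[of "Suc (base + nodes A)" k]) auto
  qed
next
  case (Orelse A B)
  from Orelse.prems consider "x \<in> set (compile base (base + nodes A) A)"
    | "x \<in> set (compile (base + nodes A) k B)" by auto
  then show ?case
  proof cases
    case 1
    then show ?thesis
      using Orelse.prems nodes_pos[of B] by (intro Orelse.IH(1)[of base "base + nodes A"]) auto
  next
    case 2
    then show ?thesis using Orelse.prems by (intro Orelse.IH(2)[of "base + nodes A" k]) auto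
  qed
qed (auto simp: node_ok_def)

section \<open>Memory layout and correctness of the query program\<close>

fun node_word :: "nat \<Rightarrow> nat \<Rightarrow> node \<Rightarrow> nat \<Rightarrow> nat" where
  "node_word d N (Branch i t l g) c = (if c = 0 then i else if c = 1 then 3 * l else 3 * g)"
| "node_word d N (Output j) c = (if c = 0 then d else 3 * N + j * d)"

fun node_real :: "node \<Rightarrow> real" where
  "node_real (Branch i t l g) = t"
| "node_real (Output j) = 0"

text \<open>A node occupies three cells in either memory, so that the word address of a node is also
  the address of its threshold. The \<open>n\<close> points follow the nodes in the real memory.\<close>

definition layout :: "nat \<Rightarrow> nat \<Rightarrow> (nat \<Rightarrow> nat \<Rightarrow> real) \<Rightarrow> node list \<Rightarrow> memory" where
  "layout d n pt C =
     (map (\<lambda>a. node_word d (length C) (C ! (a div 3)) (a mod 3)) [0..<3 * length C],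
      map (\<lambda>a. if a < 3 * length C then node_real (C ! (a div 3))
               else pt ((a - 3 * length C) div d) ((a - 3 * length C) mod d))
        [0..<3 * length C + n * d])"

text \<open>Word register 0 holds the address of the current node. Register 6 is never written and stays
  0, so the last instruction is an unconditional jump back to the loop at 2. Storing \<open>d\<close> as the
  coordinate of a node marks it as an output.\<close>

definition walk :: "nat \<Rightarrow> instr list" where
  "walk d =
    [WConst 1 1,
     WConst 2 d,
     WLoad 3 0,
     WAdd 4 0 1,
     WJump 3 2 7,
     WLoad 5 4,
     Halt 5,
     RInput 0 3,
     RLoad 1 0,
     RJump 0 1 11,
     WAdd 4 4 1,
     WLoad 0 4,
     WJump 6 1 2]"

lemma steps_add:
  "steps prog b d q (k + l) s = Option.bind (steps prog b d q k s) (steps prog b d q l)"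
  by (induction k arbitrary: s) (auto split: Option.bind_splits)

lemma steps_numeral:
  "steps prog b d q (numeral k) s =
     Option.bind (step prog b d q s) (steps prog b d q (pred_numeral k))"
  by (simp add: numeral_eq_Suc)

definition at_node :: "nat \<Rightarrow> memory \<Rightarrow> nat \<Rightarrow> config \<Rightarrow> bool" where
  "at_node d m a s \<longleftrightarrow> pc s = 2 \<and> wreg s 0 = 3 * a \<and> wreg s 1 = 1 \<and> wreg s 2 = d \<and>
     wreg s 6 = 0 \<and> wmem s = fst m \<and> rmem s = snd m"

text \<open>One round of the loop. Targets are stored multiplied by 3, so the loaded word is itself
  the address of the next node. The bound on the code length keeps the address additions from
  wrapping modulo \<open>2 ^ b\<close>.\<close>

lemma walk_branch:
  assumes s: "at_node d (layout d n pt C) a s" and C: "C ! a = Branch i t l g"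
    and a: "a < length C" and i: "i < d" and b: "3 * length C < 2 ^ b"
  shows "\<exists>k s'. k \<le> 9 \<and> steps (walk d) b d q k s = Some s' \<and>
    at_node d (layout d n pt C) (follow C q a) s'"
proof -
  have mods: "Suc (3 * a) mod 2 ^ b = Suc (3 * a)" "Suc (Suc (3 * a)) mod 2 ^ b = Suc (Suc (3 * a))"
    using a b by auto
  have len: "3 * a + 2 < 3 * length C" using a by linarith
  have words: "fst (layout d n pt C) ! (3 * a) = i"
     "fst (layout d n pt C) ! Suc (3 * a) = 3 * l"
     "fst (layout d n pt C) ! Suc (Suc (3 * a)) = 3 * g"
     "snd (layout d n pt C) ! (3 * a) = t"
     "length (fst (layout d n pt C)) = 3 * length C"
     "length (snd (layout d n pt C)) = 3 * length C + n * d"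
    using len C by (auto simp: layout_def div_Suc mod_Suc)
  show ?thesis
  proof (cases "q i < t")
    case True
    \<comment> \<open>The \<open>RJump\<close> at instruction 9 skips the \<open>WAdd\<close> at 10,
      so this round has 8 instructions instead of 9.\<close>
    show ?thesis
      using s i len
      by (intro exI[of _ 8])
         (auto simp: steps_numeral step_def at_node_def walk_def set_wreg_def set_rreg_def words
             mods True follow_def C)
  next
    case False
    show ?thesis
      using s i len
      by (intro exI[of _ 9])
         (auto simp: steps_numeral step_def at_node_def walk_def set_wreg_def set_rreg_def words
             mods False follow_def C)
  qed
qed

text \<open>The stored coordinate \<open>d\<close> fails the test against register 2, so control
  falls through to the load of the output address and stops in front of \<open>Halt\<close>, which
  is instruction 6.\<close>

lemma walk_output:
  assumes s: "at_node d (layout d n pt C) a s" and C: "C ! a = Output j"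
    and a: "a < length C" and j: "j < n" and b: "3 * length C < 2 ^ b"
  shows "\<exists>s'. steps (walk d) b d q 4 s = Some s' \<and> pc s' = 6 \<and>
    wreg s' 5 = 3 * length C + j * d \<and> rmem s' = snd (layout d n pt C)"
proof -
  have mods: "Suc (3 * a) mod 2 ^ b = Suc (3 * a)"
    using a b by auto
  have len: "3 * a + 2 < 3 * length C" using a by linarith
  have words: "fst (layout d n pt C) ! (3 * a) = d"
     "fst (layout d n pt C) ! Suc (3 * a) = 3 * length C + j * d"
     "length (fst (layout d n pt C)) = 3 * length C"
    using len C by (auto simp: layout_def div_Suc mod_Suc)
  show ?thesis
    using s len
    by (auto simp: steps_numeral step_def at_node_def walk_def set_wreg_def set_rreg_def words mods)
qed

text \<open>Each jump takes at most 9 instructions, and the final output takes 4.\<close>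

lemma walk_follow:
  assumes s: "at_node d (layout d n pt C) a s" and C: "\<forall>x\<in>set C. node_ok d n (length C) x"
    and a: "a < length C" and out: "C ! ((follow C q ^^ k) a) = Output j"
    and b: "3 * length C < 2 ^ b"
  shows "\<exists>t s'. t \<le> 9 * k + 4 \<and> j < n \<and> steps (walk d) b d q t s = Some s' \<and> pc s' = 6 \<and>
    wreg s' 5 = 3 * length C + j * d \<and> rmem s' = snd (layout d n pt C)"
  using s a out
proof (induction k arbitrary: a s)
  case 0
  then have "j < n" using C by (metis funpow_0 node_ok_def node.simps(6) nth_mem)
  then show ?case using walk_output[OF 0(1) _ 0(2) _ b, of j q] 0 by auto
next
  case (Suc k)
  show ?case
  proof (cases "C ! a")
    case (Output j')
    \<comment> \<open>An output met before the last jump is a fixed point of \<open>follow\<close>,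
      hence it is the output that the hypothesis names.\<close>
    then have "follow C q a = a" by (simp add: follow_def)
    then have "(follow C q ^^ k) a = a" for k by (induction k) auto
    then have "j' = j" using Suc.prems(3) Output by (metis node.inject(2))
    moreover have "j' < n" using C Output Suc.prems(2) by (metis node_ok_def node.simps(6) nth_mem)
    ultimately show ?thesis using walk_output[OF Suc.prems(1) Output Suc.prems(2) _ b, of q]
      by (intro exI[of _ 4]) auto
  next
    case (Branch i t l g)
    then have ok: "i < d" "l < length C" "g < length C"
      using C Suc.prems(2) nth_mem[of a C] by (force simp: node_ok_def)+
    obtain m s' where m: "m \<le> 9" "steps (walk d) b d q m s = Some s'"
      "at_node d (layout d n pt C) (follow C q a) s'"
      using walk_branch[OF Suc.prems(1) Branch Suc.prems(2) ok(1) b, of q] by blast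
    have "follow C q a < length C" using ok Branch by (simp add: follow_def)
    moreover have "C ! ((follow C q ^^ k) (follow C q a)) = Output j"
      using Suc.prems(3) by (simp add: funpow_swap1 split: option.splits)
    ultimately obtain t s'' where "t \<le> 9 * k + 4" "j < n" "steps (walk d) b d q t s' = Some s''"
      "pc s'' = 6" "wreg s'' 5 = 3 * length C + j * d" "rmem s'' = snd (layout d n pt C)"
      using Suc.IH[OF m(3)] by blast
    then show ?thesis using m by (intro exI[of _ "m + t"] exI[of _ s'']) (auto simp: steps_add)
  qed
qed

text \<open>The time consists of 2 instructions of initialisation, 9 per jump and 4 for the output.
  A failure of the whole search would continue at address 0; this exit is not taken, since
  \<open>eval\<close> succeeds.\<close>

lemma answers_search:
  fixes pt :: "nat \<Rightarrow> nat \<Rightarrow> real"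
  assumes wf: "wf_search d n S" and d: "0 < d" and ev: "eval q S = Some j"
    and b: "3 * nodes S < 2 ^ b" "d < 2 ^ b" and pt: "\<forall>j<n. pt j \<in> points d"
  shows "\<exists>t. t \<le> 9 * cost q S + 6 \<and> answers (walk d) b d (layout d n pt (compile 0 0 S)) q t (pt j)"
proof -
  define C where "C = compile 0 0 S"
  have len: "length C = nodes S" by (simp add: C_def)
  have ok: "\<forall>x\<in>set C. node_ok d n (length C) x"
    using node_ok_compile[OF wf, of 0 "nodes S" 0] d nodes_pos by (auto simp: C_def)
  obtain k where k: "k \<le> cost q S" "C ! ((follow C q ^^ k) 0) = Output j"
    using follow_compile[of C "[]" 0 0 S "[]" q] ev by (auto simp: C_def)
  define m where "m = layout d n pt C"
  \<comment> \<open>Register 1 must hold the constant 1, which needs at least one bit.\<close>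
  have "0 < b" using b(1) nodes_pos[of S] by (intro gr0I) simp
  then obtain s where s: "steps (walk d) b d q 2 (initial m) = Some s" "at_node d m 0 s"
    using b(2) by (auto simp: steps_numeral step_def at_node_def walk_def set_wreg_def initial_def)
  obtain t s' where t: "t \<le> 9 * k + 4" "j < n" "steps (walk d) b d q t s = Some s'" "pc s' = 6"
    "wreg s' 5 = 3 * length C + j * d" "rmem s' = snd m"
    using walk_follow[OF s(2)[unfolded m_def] ok _ k(2), of b] b(1) nodes_pos[of S]
    unfolding len m_def by blast
  have jd: "j * d + i < n * d" if "i < d" for i
  proof -
    have "j * d + i < Suc j * d" using that by simp
    also have "\<dots> \<le> n * d" using t(2) by (intro mult_right_mono) auto
    finally show ?thesis .
  qed
  have "wreg s' 5 + d \<le> length (rmem s')"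
    using jd[of "d - 1"] d by (simp add: t m_def layout_def)
  moreover have "pt j = (\<lambda>i\<in>{..<d}. rmem s' ! (wreg s' 5 + i))"
  proof
    fix i
    show "pt j i = (\<lambda>i\<in>{..<d}. rmem s' ! (wreg s' 5 + i)) i"
      using jd[of i] pt t(2) d by (cases "i < d") (auto simp: t m_def layout_def PiE_def extensional_def)
  qed
  moreover have "steps (walk d) b d q (2 + t) (initial m) = Some s'"
    by (simp only: steps_add s(1) t(3) Option.bind_lunit)
  ultimately have "answers (walk d) b d m q (2 + t) (pt j)"
    unfolding answers_def using t(4) by (intro exI[of _ s'] exI[of _ 5]) (simp add: walk_def)
  then show ?thesis using t(1) k(1) by (intro exI[of _ "2 + t"]) (simp add: m_def C_def)
qed

lemma layout_words:
  assumes "wf_search d n S" "0 < d" "v \<in> set (fst (layout d n pt (compile 0 0 S)))"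
  shows "v \<le> 3 * nodes S + n * d + d"
proof -
  obtain a where a: "a < 3 * nodes S"
    "v = node_word d (nodes S) (compile 0 0 S ! (a div 3)) (a mod 3)"
    using assms(3) by (auto simp: layout_def)
  then have "a div 3 < length (compile 0 0 S)" by simp
  then have ok: "node_ok d n (nodes S) (compile 0 0 S ! (a div 3))"
    using node_ok_compile[OF assms(1), of 0 "nodes S" 0] assms(2) nodes_pos[of S] nth_mem by force
  show ?thesis
  proof (cases "compile 0 0 S ! (a div 3)")
    case (Branch i t l g)
    then have "i < d" "l < nodes S" "g < nodes S" using ok by (auto simp: node_ok_def)
    then show ?thesis using Branch a by auto
  next
    case (Output j)
    then have "j < n" using ok by (simp add: node_ok_def)
    then have "j * d \<le> n * d" by simp
    then have "j * d \<le> n * d + d" by linarith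
    then show ?thesis using Output a by simp
  qed
qed

section \<open>Decision trees for weighted maximum norms\<close>

text \<open>If every step satisfied \<open>a (Suc k) / m < (a k / m) powr \<rho>\<close>, the
  fraction would fall from at most 1/2 to at most \<open>(1 / 2) powr (\<rho> ^ J)\<close>, hence to
  \<open>1 / (4 d)\<close>. So if \<open>a J\<close> is still large, some step is slow, and by
  antitonicity more than \<open>m / (4 d)\<close> points lie beyond it.\<close>

lemma tail_dichotomy:
  fixes a :: "nat \<Rightarrow> nat"
  assumes anti: "antimono a" and a0: "2 * a 0 \<le> m" and m: "0 < m" and d: "0 < d"
    and rho: "1 < \<rho>" and J: "(1 / 2) powr (\<rho> ^ J) \<le> 1 / (4 * real d)"
  shows "4 * d * a J \<le> m \<or>
    (\<exists>k<J. m < 4 * d * a (Suc k) \<and> (a k / m) powr \<rho> \<le> a (Suc k) / m)"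
proof (rule ccontr)
  assume neg: "\<not> ?thesis"
  have big: "m < 4 * d * a k" if "k \<le> J" for k
  proof -
    have "4 * d * a J \<le> 4 * d * a k" using antimonoD[OF anti that] by simp
    then show ?thesis using neg by linarith
  qed
  have "a k / m \<le> (1 / 2) powr (\<rho> ^ k)" if "k \<le> J" for k
    using that
  proof (induction k)
    case 0
    have "real (2 * a 0) \<le> m" using a0 by (rule of_nat_mono)
    then show ?case using m by (simp add: field_simps)
  next
    case (Suc k)
    have "a (Suc k) / m \<le> (a k / m) powr \<rho>"
      using neg big[of "Suc k"] Suc.prems by (meson Suc_le_lessD linear)
    also have "\<dots> \<le> ((1 / 2) powr (\<rho> ^ k)) powr \<rho>"
      using Suc rho by (intro powr_mono2) auto
    also have "\<dots> = (1 / 2) powr (\<rho> ^ Suc k)" by (simp add: powr_powr mult.commute)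
    finally show ?case .
  qed
  then have "a J / m \<le> 1 / (4 * real d)" using J by force
  then have "real (4 * d * a J) \<le> m" using m d by (simp add: field_simps)
  then have "4 * d * a J \<le> m" by (simp only: of_nat_le_iff)
  then show False using big[of J] by simp
qed

text \<open>After division by \<open>m powr \<rho>\<close> the two terms are at most
  \<open>1 - a' / m\<close>, because \<open>x powr \<rho> \<le> x\<close> on the unit interval, and
  \<open>a' / m\<close>. Thus a cut at a slow step does not increase the potential
  \<open>card powr \<rho>\<close>, although \<open>a - a'\<close> points are duplicated.\<close>

lemma powr_split:
  fixes a a' m :: nat
  assumes "0 < m" "1 \<le> \<rho>" "a' \<le> m" "(a / m) powr \<rho> \<le> a' / m"
  shows "real (m - a') powr \<rho> + a powr \<rho> \<le> m powr \<rho>"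
proof -
  have le: "x powr \<rho> \<le> x" if "0 \<le> x" "x \<le> 1" for x :: real
    using powr_mono'[of 1 \<rho> x] that assms(2) by (cases "x = 0") auto
  have "real (m - a') powr \<rho> = (m * (1 - a' / m)) powr \<rho>"
    using assms by (simp add: of_nat_diff algebra_simps)
  also have "\<dots> = m powr \<rho> * (1 - a' / m) powr \<rho>"
    using assms by (subst powr_mult) auto
  also have "\<dots> \<le> m powr \<rho> * (1 - a' / m)"
    using assms by (intro mult_left_mono le) auto
  finally have 1: "real (m - a') powr \<rho> \<le> m powr \<rho> * (1 - a' / m)" .
  have "a powr \<rho> = (m * (a / m)) powr \<rho>" using assms by simp
  also have "\<dots> = m powr \<rho> * (a / m) powr \<rho>"
    using assms by (subst powr_mult) auto
  also have "\<dots> \<le> m powr \<rho> * (a' / m)"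
    using assms by (intro mult_left_mono) auto
  finally show ?thesis using 1 by (simp add: algebra_simps)
qed

text \<open>The median is the least value \<open>x\<close> such that at least half of the points
  have value at most \<open>x\<close>.\<close>

lemma median_exists:
  fixes v :: "'a \<Rightarrow> real"
  assumes "finite I" "I \<noteq> {}"
  shows "\<exists>x. 2 * card {j \<in> I. v j < x} \<le> card I \<and> 2 * card {j \<in> I. x < v j} \<le> card I"
proof -
  define X where "X = {x \<in> v ` I. card I \<le> 2 * card {j \<in> I. v j \<le> x}}"
  have "Max (v ` I) \<in> X"
  proof -
    have "{j \<in> I. v j \<le> Max (v ` I)} = I" using assms by auto
    then show ?thesis using assms by (simp add: X_def)
  qed
  then have "X \<noteq> {}" by blast
  moreover have "finite X" using assms by (simp add: X_def)
  ultimately have X: "finite X" "X \<noteq> {}" by auto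
  define x where "x = Min X"
  have x: "x \<in> X" unfolding x_def using X by (rule Min_in)
  have "2 * card {j \<in> I. v j < x} \<le> card I"
  proof (cases "{j \<in> I. v j < x} = {}")
    case False
    \<comment> \<open>The largest value below \<open>x\<close> is not in \<open>X\<close>, so fewer
      than half of the points have value at most \<open>y\<close>.\<close>
    define y where "y = Max (v ` {j \<in> I. v j < x})"
    have y: "y \<in> v ` {j \<in> I. v j < x}"
      unfolding y_def using False assms by (intro Max_in) auto
    have le: "v j \<le> y" if "j \<in> I" "v j < x" for j
      unfolding y_def using that assms by (intro Max_ge) auto
    have "{j \<in> I. v j < x} = {j \<in> I. v j \<le> y}"
      using y le by force
    moreover have "y \<notin> X" using y X Min_le[of X y] by (auto simp: x_def)
    ultimately show ?thesis using y by (auto simp: X_def)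
  next
    case True
    then show ?thesis by (simp only: card.empty)
  qed
  moreover have "2 * card {j \<in> I. x < v j} \<le> card I"
  proof -
    have "card {j \<in> I. v j \<le> x} + card {j \<in> I. x < v j} = card I"
      using assms by (subst card_Un_disjoint[symmetric]) (auto intro!: arg_cong[of _ _ card])
    then show ?thesis using x by (simp add: X_def)
  qed
  ultimately show ?thesis by blast
qed

section \<open>Box tests, cuts and the decision tree\<close>

primrec box_check :: "nat \<Rightarrow> (nat \<Rightarrow> real) \<Rightarrow> (nat \<Rightarrow> real) \<Rightarrow> search \<Rightarrow> search" where
  "box_check 0 lo hi S = S"
| "box_check (Suc k) lo hi S = Cmp k (lo k) Fail (Cmp k (hi k) (box_check k lo hi S) Fail)"

lemma eval_box_check:
  "eval q (box_check k lo hi S) = (if \<forall>i<k. lo i \<le> q i \<and> q i < hi i then eval q S else None)"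
  by (induction k) (auto simp: less_Suc_eq)

text \<open>Two comparisons per coordinate, and 1 for a possible \<open>Fail\<close> leaf.\<close>

lemma cost_box_check: "cost q (box_check k lo hi (Found j)) \<le> 2 * k + 1"
  by (induction k) auto

lemma nodes_box_check: "nodes (box_check k lo hi S) = 4 * k + nodes S"
  by (induction k) auto

lemma wf_box_check: "k \<le> d \<Longrightarrow> wf_search d n S \<Longrightarrow> wf_search d n (box_check k lo hi S)"
  by (induction k) auto

text \<open>Near neighbour search for the maximum norm weighted by \<open>1 / u\<close>, with
  threshold 1 and approximation \<open>D\<close>, correct on all queries. A failure certifies that
  no point of \<open>I\<close> is near, which is what allows \<open>Orelse\<close> to pass on to
  other points.\<close>

definition solves :: "nat \<Rightarrow> (nat \<Rightarrow> nat \<Rightarrow> real) \<Rightarrow> (nat \<Rightarrow> real) \<Rightarrow> real \<Rightarrow> nat set \<Rightarrow> search \<Rightarrow> bool" where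
  "solves d pt u D I S \<longleftrightarrow> (\<forall>q. case eval q S of
      None \<Rightarrow> \<forall>j\<in>I. \<exists>i<d. u i < \<bar>pt j i - q i\<bar>
    | Some j \<Rightarrow> j \<in> I \<and> (\<forall>i<d. \<bar>pt j i - q i\<bar> \<le> D * u i))"

text \<open>Points within \<open>u i\<close> of the cut go to both sides. A point missing on one
  side is farther than \<open>u i\<close> from every query sent there, so no near point is
  lost.\<close>

lemma solves_Cmp:
  assumes "i < d" "solves d pt u D {j \<in> I. pt j i < s + u i} A"
    "solves d pt u D {j \<in> I. s - u i \<le> pt j i} B"
  shows "solves d pt u D I (Cmp i s A B)"
  unfolding solves_def
proof
  fix q
  show "case eval q (Cmp i s A B) of None \<Rightarrow> \<forall>j\<in>I. \<exists>i<d. u i < \<bar>pt j i - q i\<bar>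
    | Some j \<Rightarrow> j \<in> I \<and> (\<forall>i<d. \<bar>pt j i - q i\<bar> \<le> D * u i)"
  proof (cases "q i < s")
    case True
    have "u i < \<bar>pt j i - q i\<bar>" if "\<not> pt j i < s + u i" for j
      using that True by linarith
    then show ?thesis using assms(2)[unfolded solves_def, rule_format, of q] True assms(1)
      by (simp split: option.splits) blast
  next
    case False
    have "u i < \<bar>pt j i - q i\<bar>" if "\<not> s - u i \<le> pt j i" for j
      using that False by linarith
    then show ?thesis using assms(3)[unfolded solves_def, rule_format, of q] False assms(1)
      by (simp split: option.splits) blast
  qed
qed

text \<open>For a query in the box enlarged by \<open>u\<close>, any fixed point \<open>j\<close> of
  the box is close enough. For any other query, the violated coordinate shows that every point of
  the box is farther than \<open>u\<close>, so only the points outside remain to be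
  searched.\<close>

lemma solves_box:
  assumes B: "B = {j \<in> I. \<forall>i<d. lo i \<le> pt j i \<and> pt j i < hi i}" and j: "j \<in> B"
    and D: "\<forall>i<d. hi i - lo i + u i \<le> D * u i" and S: "solves d pt u D (I - B) S"
  shows "solves d pt u D I
    (Orelse (box_check d (\<lambda>i. lo i - u i) (\<lambda>i. hi i + u i) (Found j)) S)"
  unfolding solves_def
proof
  fix q
  show "case eval q (Orelse (box_check d (\<lambda>i. lo i - u i) (\<lambda>i. hi i + u i) (Found j)) S) of
      None \<Rightarrow> \<forall>j\<in>I. \<exists>i<d. u i < \<bar>pt j i - q i\<bar>
    | Some j \<Rightarrow> j \<in> I \<and> (\<forall>i<d. \<bar>pt j i - q i\<bar> \<le> D * u i)"
  proof (cases "\<forall>i<d. lo i - u i \<le> q i \<and> q i < hi i + u i")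
    case True
    have "\<bar>pt j i - q i\<bar> \<le> D * u i" if i: "i < d" for i
    proof -
      have "lo i \<le> pt j i" "pt j i < hi i" using j i by (auto simp: B)
      then have "\<bar>pt j i - q i\<bar> \<le> hi i - lo i + u i" using True i by force
      then show ?thesis using D i by force
    qed
    then show ?thesis using True j by (auto simp: eval_box_check B)
  next
    case False
    then obtain i where i: "i < d" "\<not> (lo i - u i \<le> q i \<and> q i < hi i + u i)" by blast
    have "u i < \<bar>pt j i - q i\<bar>" if "j \<in> B" for j
    proof -
      have "lo i \<le> pt j i" "pt j i < hi i" using that i by (auto simp: B)
      then show ?thesis using i(2) by linarith
    qed
    then have "\<forall>j\<in>B. \<exists>i<d. u i < \<bar>pt j i - q i\<bar>" using i by blast
    then show ?thesis using S[unfolded solves_def, rule_format, of q] False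
      by (auto simp: eval_box_check split: option.splits)
  qed
qed

text \<open>\<open>tail_dichotomy\<close> is applied to both tails of every coordinate, starting at
  a median. A slow step yields a cut. If all \<open>2 d\<close> tails become small within
  \<open>J\<close> steps, the union bound leaves at most half of the points outside the central
  box.\<close>

lemma split_or_box:
  fixes pt :: "nat \<Rightarrow> nat \<Rightarrow> real"
  assumes I: "finite I" "I \<noteq> {}" and u: "\<forall>i<d. 0 < u i" and d: "0 < d"
    and rho: "1 < \<rho>" and J: "(1 / 2) powr (\<rho> ^ J) \<le> 1 / (4 * real d)"
  obtains i s where "i < d"
      "{j \<in> I. pt j i < s + u i} \<noteq> {}" "{j \<in> I. s - u i \<le> pt j i} \<noteq> {}"
      "card {j \<in> I. pt j i < s + u i} \<le> (1 - 1 / (4 * real d)) * card I"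
      "card {j \<in> I. s - u i \<le> pt j i} \<le> (1 - 1 / (4 * real d)) * card I"
      "card {j \<in> I. pt j i < s + u i} powr \<rho> + card {j \<in> I. s - u i \<le> pt j i} powr \<rho>
        \<le> card I powr \<rho>"
  | lo hi where "\<forall>i<d. hi i - lo i = (4 * real J + 1) * u i"
      "2 * card {j \<in> I. \<not> (\<forall>i<d. lo i \<le> pt j i \<and> pt j i < hi i)} \<le> card I"
proof -
  define m where "m = card I"
  have m: "0 < m" using I by (auto simp: m_def card_gt_0_iff)
  have "\<exists>x. \<forall>i. 2 * card {j \<in> I. pt j i < x i} \<le> m \<and> 2 * card {j \<in> I. x i < pt j i} \<le> m"
    unfolding m_def by (intro choice allI median_exists[OF I])
  then obtain x where x: "\<And>i. 2 * card {j \<in> I. pt j i < x i} \<le> m"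
      "\<And>i. 2 * card {j \<in> I. x i < pt j i} \<le> m"
    by blast
  \<comment> \<open>The right tails use a non-strict inequality and therefore start at
    \<open>x i + u i\<close>, so that \<open>R i 0\<close> excludes points equal to the median.
    Consecutive thresholds differ by two widths, leaving room for one width on either side of a
    cut.\<close>
  define R where "R i k = {j \<in> I. x i + u i + 2 * real k * u i \<le> pt j i}" for i k
  define L where "L i k = {j \<in> I. pt j i < x i - 2 * real k * u i}" for i k
  have fin: "finite (R i k)" "finite (L i k)" for i k using I by (auto simp: R_def L_def)
  have R_anti: "antimono (\<lambda>k. card (R i k))" if i: "i < d" for i
  proof (rule antimonoI)
    fix k l :: nat assume "k \<le> l"
    then have "real k * u i \<le> real l * u i" using u i by (intro mult_right_mono) auto
    then show "card (R i l) \<le> card (R i k)" using fin by (intro card_mono) (auto simp: R_def)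
  qed
  have L_anti: "antimono (\<lambda>k. card (L i k))" if i: "i < d" for i
  proof (rule antimonoI)
    fix k l :: nat assume "k \<le> l"
    then have "real k * u i \<le> real l * u i" using u i by (intro mult_right_mono) auto
    then show "card (L i l) \<le> card (L i k)" using fin by (intro card_mono) (auto simp: L_def)
  qed
  have R0: "2 * card (R i 0) \<le> m" if "i < d" for i
  proof -
    have "card (R i 0) \<le> card {j \<in> I. x i < pt j i}"
      using I u that by (intro card_mono) (auto simp: R_def intro: less_le_trans[of _ "x i + u i"])
    then show ?thesis using x(2)[of i] by linarith
  qed
  have L0: "2 * card (L i 0) \<le> m" for i using x(1)[of i] by (simp add: L_def)
  \<comment> \<open>Here \<open>a\<close> and \<open>a'\<close> count the points beyond the near and
    the far end of a step. The two sides of the cut then have \<open>a\<close> and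
    \<open>m - a'\<close> points.\<close>
  have quant: "0 < m - a'" "0 < a" "real (m - a') \<le> (1 - 1 / (4 * real d)) * m"
      "real a \<le> (1 - 1 / (4 * real d)) * m" "real (m - a') powr \<rho> + a powr \<rho> \<le> m powr \<rho>"
    if a: "m < 4 * d * a'" "(a / m) powr \<rho> \<le> a' / m" "a' \<le> a" "2 * a \<le> m" for a a' :: nat
  proof -
    show "0 < m - a'" "0 < a" using a m by (auto intro!: gr0I)
    have "real m < 4 * d * a'" using of_nat_less_iff[THEN iffD2, OF a(1)] by simp
    then have "m / (4 * real d) \<le> a'" using d by (simp add: field_simps)
    then show "real (m - a') \<le> (1 - 1 / (4 * real d)) * m"
      using a by (simp add: of_nat_diff algebra_simps)
    have "1 / (4 * real d) \<le> 1 / 2" using d by (simp add: field_simps)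
    then have "(1 / 2) * real m \<le> (1 - 1 / (4 * real d)) * m" by (intro mult_right_mono) auto
    then show "real a \<le> (1 - 1 / (4 * real d)) * m" using a(4) by linarith
    show "real (m - a') powr \<rho> + a powr \<rho> \<le> m powr \<rho>"
      using a m rho by (intro powr_split) auto
  qed
  have compl: "card (I - A) = m - card A" if "A \<subseteq> I" for A
    using that I by (simp add: m_def card_Diff_subset finite_subset)
  show thesis
  proof (cases "\<forall>i<d. 4 * d * card (R i J) \<le> m \<and> 4 * d * card (L i J) \<le> m")
    case True
    define lo where "lo i = x i - 2 * real J * u i" for i
    define hi where "hi i = x i + u i + 2 * real J * u i" for i
    have "{j \<in> I. \<not> (\<forall>i<d. lo i \<le> pt j i \<and> pt j i < hi i)} = (\<Union>i<d. R i J \<union> L i J)"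
      by (auto simp: R_def L_def lo_def hi_def not_le not_less)
    then have "card {j \<in> I. \<not> (\<forall>i<d. lo i \<le> pt j i \<and> pt j i < hi i)}
        \<le> (\<Sum>i<d. card (R i J \<union> L i J))" by (simp add: card_UN_le)
    also have "\<dots> \<le> (\<Sum>i<d. card (R i J) + card (L i J))"
      by (intro sum_mono card_Un_le)
    finally have "4 * d * card {j \<in> I. \<not> (\<forall>i<d. lo i \<le> pt j i \<and> pt j i < hi i)}
        \<le> 4 * d * (\<Sum>i<d. card (R i J) + card (L i J))" by simp
    also have "\<dots> = (\<Sum>i<d. 4 * d * card (R i J) + 4 * d * card (L i J))"
      by (simp add: sum_distrib_left distrib_left)
    also have "\<dots> \<le> (\<Sum>i<d. m + m)" using True by (intro sum_mono add_mono) auto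
    also have "\<dots> = 2 * d * m" by simp
    finally have "2 * card {j \<in> I. \<not> (\<forall>i<d. lo i \<le> pt j i \<and> pt j i < hi i)} \<le> m"
      using d by (simp add: mult.assoc)
    moreover have "\<forall>i<d. hi i - lo i = (4 * real J + 1) * u i"
      by (simp add: lo_def hi_def algebra_simps)
    ultimately show thesis using that(2) by (simp add: m_def)
  next
    case False
    then obtain i where i: "i < d" "\<not> 4 * d * card (R i J) \<le> m \<or> \<not> 4 * d * card (L i J) \<le> m"
      by blast
    from i(2) show thesis
    proof
      assume "\<not> 4 * d * card (R i J) \<le> m"
      then obtain k where k: "m < 4 * d * card (R i (Suc k))"
          "(card (R i k) / m) powr \<rho> \<le> card (R i (Suc k)) / m"
        using tail_dichotomy[OF R_anti[OF i(1)] R0[OF i(1)] m d rho J] by blast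
      \<comment> \<open>The cut is the midpoint of step \<open>k\<close>: its ends
        \<open>s - u i\<close> and \<open>s + u i\<close> are the thresholds of \<open>R i k\<close>
        and \<open>R i (Suc k)\<close>.\<close>
      define s where "s = x i + u i + (2 * real k + 1) * u i"
      have A: "{j \<in> I. pt j i < s + u i} = I - R i (Suc k)" "{j \<in> I. s - u i \<le> pt j i} = R i k"
        by (auto simp: R_def s_def algebra_simps)
      have c: "card {j \<in> I. pt j i < s + u i} = m - card (R i (Suc k))"
        unfolding A by (rule compl) (auto simp: R_def)
      have le: "card (R i (Suc k)) \<le> card (R i k)" "card (R i k) \<le> card (R i 0)"
        using antimonoD[OF R_anti[OF i(1)], of k "Suc k"] antimonoD[OF R_anti[OF i(1)], of 0 k]
        by simp_all
      then have "2 * card (R i k) \<le> m" using R0[OF i(1)] by linarith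
      note q = quant[OF k le(1) this]
      show thesis
      proof (rule that(1)[OF i(1), of s])
        show "{j \<in> I. pt j i < s + u i} \<noteq> {}" using q(1) c by (metis card.empty less_irrefl)
        show "{j \<in> I. s - u i \<le> pt j i} \<noteq> {}" using q(2) A(2) by (metis card.empty less_irrefl)
      qed (use q(3-5) in \<open>simp_all only: c A(2) m_def[symmetric]\<close>)
    next
      assume "\<not> 4 * d * card (L i J) \<le> m"
      then obtain k where k: "m < 4 * d * card (L i (Suc k))"
          "(card (L i k) / m) powr \<rho> \<le> card (L i (Suc k)) / m"
        using tail_dichotomy[OF L_anti[OF i(1)] L0 m d rho J] by blast
      define s where "s = x i - (2 * real k + 1) * u i"
      have A: "{j \<in> I. pt j i < s + u i} = L i k" "{j \<in> I. s - u i \<le> pt j i} = I - L i (Suc k)"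
        by (auto simp: L_def s_def algebra_simps)
      have c: "card {j \<in> I. s - u i \<le> pt j i} = m - card (L i (Suc k))"
        unfolding A by (rule compl) (auto simp: L_def)
      have le: "card (L i (Suc k)) \<le> card (L i k)" "card (L i k) \<le> card (L i 0)"
        using antimonoD[OF L_anti[OF i(1)], of k "Suc k"] antimonoD[OF L_anti[OF i(1)], of 0 k]
        by simp_all
      then have "2 * card (L i k) \<le> m" using L0[of i] by linarith
      note q = quant[OF k le(1) this]
      show thesis
      proof (rule that(1)[OF i(1), of s])
        show "{j \<in> I. pt j i < s + u i} \<noteq> {}" using q(2) A(1) by (metis card.empty less_irrefl)
        show "{j \<in> I. s - u i \<le> pt j i} \<noteq> {}" using q(1) c by (metis card.empty less_irrefl)
      qed (use q(3-5) in \<open>simp_all only: c A(1) m_def[symmetric] add.commute\<close>)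
    qed
  qed
qed

text \<open>Induction on the point set by \<open>split_or_box\<close>. A cut leaves the sum of
  \<open>card powr \<rho>\<close> bounded, and the term \<open>- 1\<close> in the size bound pays
  for its node. A cut shrinks \<open>card\<close> by the factor \<open>1 - 1 / (4 d)\<close> and a
  box halves it, so the logarithm in the cost bound pays for all comparisons. The factor
  \<open>4 J + 2\<close> is the side of the box plus one width.\<close>

lemma search_tree:
  fixes pt :: "nat \<Rightarrow> nat \<Rightarrow> real"
  assumes "finite I" "I \<subseteq> {..<n}" and u: "\<forall>i<d. 0 < u i" and d: "0 < d"
    and rho: "1 < \<rho>" and J: "(1 / 2) powr (\<rho> ^ J) \<le> 1 / (4 * real d)"
  shows "\<exists>S. wf_search d n S \<and> solves d pt u (4 * real J + 2) I S \<and>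
    (if I = {} then nodes S = 1 \<and> (\<forall>q. cost q S = 1)
     else nodes S \<le> (4 * real d + 2) * (2 * card I powr \<rho> - 1) \<and>
       (\<forall>q. cost q S \<le> 6 * real d * (1 + ln (card I))))"
  using assms(1,2)
proof (induction I rule: finite_psubset_induct)
  case (psubset I)
  show ?case
  proof (cases "I = {}")
    case True
    then show ?thesis by (intro exI[of _ Fail]) (simp add: solves_def)
  next
    case False
    define m where "m = card I"
    have m: "1 \<le> m" using False psubset.hyps by (simp add: m_def Suc_le_eq card_gt_0_iff)
    have d1: "1 \<le> real d" using d by simp
    \<comment> \<open>\<open>W\<close> is the size of a box test together with one
      \<open>Fail\<close> leaf.\<close>
    define W where "W = 4 * real d + 2"
    from False have "I \<noteq> {}" .
    then show ?thesis
    proof (rule split_or_box[OF psubset.hyps _ u d rho J, of pt])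
      fix i s
      define A where "A = {j \<in> I. pt j i < s + u i}"
      define B where "B = {j \<in> I. s - u i \<le> pt j i}"
      assume i: "i < d"
        and "{j \<in> I. pt j i < s + u i} \<noteq> {}" "{j \<in> I. s - u i \<le> pt j i} \<noteq> {}"
          "card {j \<in> I. pt j i < s + u i} \<le> (1 - 1 / (4 * real d)) * card I"
          "card {j \<in> I. s - u i \<le> pt j i} \<le> (1 - 1 / (4 * real d)) * card I"
          "card {j \<in> I. pt j i < s + u i} powr \<rho> + card {j \<in> I. s - u i \<le> pt j i} powr \<rho>
            \<le> card I powr \<rho>"
      then have AB: "A \<noteq> {}" "B \<noteq> {}" "card A \<le> (1 - 1 / (4 * real d)) * m"
          "card B \<le> (1 - 1 / (4 * real d)) * m" "card A powr \<rho> + card B powr \<rho> \<le> m powr \<rho>"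
        by (simp_all add: A_def B_def m_def)
      have fin: "finite A" "finite B" using psubset.hyps by (auto simp: A_def B_def)
      have "(1 - 1 / (4 * real d)) * m < 1 * real m"
        using m d by (intro mult_strict_right_mono) auto
      then have "A \<noteq> I" "B \<noteq> I" using AB(3,4) by (auto simp: m_def)
      then have "A \<subset> I" "B \<subset> I" by (auto simp: A_def B_def)
      moreover have "\<exists>S. wf_search d n S \<and> solves d pt u (4 * real J + 2) X S \<and>
          nodes S \<le> W * (2 * card X powr \<rho> - 1) \<and>
          (\<forall>q. cost q S \<le> 6 * real d * (1 + ln (card X)))" if X: "X \<subset> I" "X \<noteq> {}" for X
      proof -
        have "X \<subseteq> {..<n}" using X psubset.prems by blast
        from psubset.IH[OF X(1) this] show ?thesis using X(2) by (simp add: W_def)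
      qed
      ultimately obtain S T where S: "wf_search d n S" "solves d pt u (4 * real J + 2) A S"
            "nodes S \<le> W * (2 * card A powr \<rho> - 1)"
            "\<And>q. cost q S \<le> 6 * real d * (1 + ln (card A))"
          and T: "wf_search d n T" "solves d pt u (4 * real J + 2) B T"
            "nodes T \<le> W * (2 * card B powr \<rho> - 1)"
            "\<And>q. cost q T \<le> 6 * real d * (1 + ln (card B))"
        using AB(1,2) by meson
      have "nodes (Cmp i s S T) \<le> 1 + W * (2 * card A powr \<rho> - 1) + W * (2 * card B powr \<rho> - 1)"
        using S(3) T(3) by simp
      also have "\<dots> = 1 - W + W * (2 * (card A powr \<rho> + card B powr \<rho>) - 1)"
        by (simp add: algebra_simps)
      also have "\<dots> \<le> 0 + W * (2 * m powr \<rho> - 1)"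
        using AB(5) by (intro add_mono mult_left_mono) (auto simp: W_def)
      finally have nodes: "nodes (Cmp i s S T) \<le> W * (2 * m powr \<rho> - 1)" by simp
      have drop: "1 + 6 * real d * (1 + ln (card X)) \<le> 6 * real d * (1 + ln m)"
        if X: "X \<noteq> {}" "finite X" "card X \<le> (1 - 1 / (4 * real d)) * m" for X :: "nat set"
      proof -
        have c: "0 < card X" using X by (simp add: card_gt_0_iff)
        have p: "0 < 1 - 1 / (4 * real d)" using d1 by (simp add: field_simps)
        have "ln (card X) \<le> ln ((1 - 1 / (4 * real d)) * m)"
          using X(3) c by (subst ln_le_cancel_iff) auto
        also have "\<dots> = ln (1 - 1 / (4 * real d)) + ln m" using p m by (subst ln_mult) auto
        also have "\<dots> \<le> - 1 / (4 * real d) + ln m"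
          using ln_le_minus_one[OF p] by simp
        \<comment> \<open>The logarithm falls by at least \<open>1 / (4 d)\<close>, which is worth
          3/2 of cost and covers the single comparison.\<close>
        finally have "6 * real d * (1 + ln (card X)) \<le> 6 * real d * (1 + (- 1 / (4 * real d) + ln m))"
          by (intro mult_left_mono) auto
        also have "\<dots> = 6 * real d * (1 + ln m) - 3 / 2" using d by (simp add: field_simps)
        finally show ?thesis by simp
      qed
      have "cost q (Cmp i s S T) \<le> 6 * real d * (1 + ln m)" for q
        using S(4)[of q] T(4)[of q] drop[OF AB(1) fin(1) AB(3)] drop[OF AB(2) fin(2) AB(4)] by simp
      then show ?thesis
        using nodes False S T i solves_Cmp[OF i S(2)[unfolded A_def] T(2)[unfolded B_def]]
        by (intro exI[of _ "Cmp i s S T"]) (simp add: m_def W_def)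
    next
      fix lo hi
      assume w: "\<forall>i<d. hi i - lo i = (4 * real J + 1) * u i"
        and half: "2 * card {j \<in> I. \<not> (\<forall>i<d. lo i \<le> pt j i \<and> pt j i < hi i)} \<le> card I"
      define B where "B = {j \<in> I. \<forall>i<d. lo i \<le> pt j i \<and> pt j i < hi i}"
      have "{j \<in> I. \<not> (\<forall>i<d. lo i \<le> pt j i \<and> pt j i < hi i)} = I - B" by (auto simp: B_def)
      then have half: "2 * card (I - B) \<le> m" using half by (simp add: m_def)
      have "B \<noteq> {}" using half m by (intro notI) (simp add: m_def)
      then obtain j where j: "j \<in> B" by blast
      then have "I - B \<subset> I" by (auto simp: B_def)
      then obtain S where S: "wf_search d n S" "solves d pt u (4 * real J + 2) (I - B) S"
            "if I - B = {} then nodes S = 1 \<and> (\<forall>q. cost q S = 1)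
             else nodes S \<le> W * (2 * card (I - B) powr \<rho> - 1) \<and>
               (\<forall>q. cost q S \<le> 6 * real d * (1 + ln (card (I - B))))"
        using psubset.IH[of "I - B"] psubset.prems unfolding W_def by auto
      define T where "T = box_check d (\<lambda>i. lo i - u i) (\<lambda>i. hi i + u i) (Found j)"
      have T: "nodes T = 4 * d + 1" "cost q T \<le> 2 * d + 1" for q
        unfolding T_def using cost_box_check[of q d] by (simp_all add: nodes_box_check)
      have "j < n" using j psubset.prems by (auto simp: B_def)
      then have wf: "wf_search d n (Orelse T S)" using S by (simp add: T_def wf_box_check)
      have sol: "solves d pt u (4 * real J + 2) I (Orelse T S)"
        unfolding T_def using w S(2) by (intro solves_box[OF B_def j]) (auto simp: algebra_simps)
      have m_rho: "1 \<le> m powr \<rho>" using m rho by (intro ge_one_powr_ge_zero) auto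
      have "nodes (Orelse T S) \<le> W * (2 * m powr \<rho> - 1) \<and>
         (\<forall>q. cost q (Orelse T S) \<le> 6 * real d * (1 + ln m))"
      proof (cases "I - B = {}")
        case True
        have "W * 1 \<le> W * (2 * m powr \<rho> - 1)"
          using m_rho by (intro mult_left_mono) (auto simp: W_def)
        moreover have "cost q (Orelse T S) \<le> 6 * real d * (1 + ln m)" for q
        proof -
          have "cost q (Orelse T S) \<le> 2 * d + 2" using S(3) True T(2)[of q] by simp
          then have "real (cost q (Orelse T S)) \<le> 6 * d" using d by linarith
          also have "\<dots> = 6 * real d * 1" by simp
          also have "\<dots> \<le> 6 * real d * (1 + ln m)" using m by (intro mult_left_mono) auto
          finally show ?thesis .
        qed
        moreover have "real (nodes (Orelse T S)) = W * 1"
          using S(3) True T(1) by (simp add: W_def)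
        ultimately show ?thesis by presburger
      next
        case F: False
        define m' where "m' = card (I - B)"
        have m': "1 \<le> m'" "2 * m' \<le> m"
          using F psubset.hyps half by (auto simp: m'_def Suc_le_eq card_gt_0_iff)
        \<comment> \<open>Since \<open>\<rho>\<close> exceeds 1, halving the set at least halves the
          potential. The half that is freed pays for the box test.\<close>
        have "2 * m' powr \<rho> \<le> 2 powr \<rho> * m' powr \<rho>"
          using powr_mono[of 1 \<rho> 2] rho by (intro mult_right_mono) auto
        also have "\<dots> = (2 * real m') powr \<rho>" by (simp add: powr_mult)
        also have "\<dots> \<le> m powr \<rho>" using m' rho by (intro powr_mono2) auto
        finally have le: "2 * m' powr \<rho> \<le> m powr \<rho>" .
        have "nodes (Orelse T S) \<le> W * 1 + W * (2 * m' powr \<rho> - 1)"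
          using S(3) F T(1) by (simp add: W_def m'_def)
        also have "\<dots> \<le> W * (2 * m powr \<rho> - 1)"
          unfolding distrib_left[symmetric] using le m_rho by (intro mult_left_mono) (auto simp: W_def)
        finally have nodes: "nodes (Orelse T S) \<le> W * (2 * m powr \<rho> - 1)" .
        have "ln (2 * real m') \<le> ln m" using m' by (subst ln_le_cancel_iff) auto
        \<comment> \<open>Halving lowers the logarithm by at least 1/2, which is worth
          \<open>3 d\<close> of cost; the box test needs \<open>2 d + 1\<close>.\<close>
        then have "ln m' \<le> ln m - 1 / 2" using ln2_ge_two_thirds m' by (simp add: ln_mult)
        then have "6 * real d * (1 + ln m') \<le> 6 * real d * (1 + (ln m - 1 / 2))"
          by (intro mult_left_mono) auto
        also have "\<dots> = 6 * real d * (1 + ln m) - 3 * real d" by (simp add: algebra_simps)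
        finally have drop: "3 * real d + 6 * real d * (1 + ln m') \<le> 6 * real d * (1 + ln m)"
          by simp
        have "cost q (Orelse T S) \<le> 6 * real d * (1 + ln m)" for q
        proof -
          have "cost q S \<le> 6 * real d * (1 + ln m')" using S(3) F by (simp add: m'_def)
          moreover have "real (cost q T) \<le> 2 * d + 1" using T(2)[of q] by linarith
          ultimately show ?thesis using drop d1 by simp
        qed
        then show ?thesis using nodes by blast
      qed
      then show ?thesis using wf sol False
        by (intro exI[of _ "Orelse T S"]) (simp add: m_def W_def)
    qed
  qed
qed

section \<open>Random widths\<close>

abbreviation unif :: "real measure" where
  "unif \<equiv> uniform_measure lborel {0..1}"

lemma prob_space_unif: "prob_space unif"
  by (intro prob_space_uniform_measure) auto

lemma measure_unif_atMost:
  assumes "0 \<le> x" "x \<le> 1"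
  shows "measure unif {..x} = x"
proof -
  have "{0..1} \<inter> {..x} = {0..x}" using assms by auto
  then show ?thesis using assms by (subst measure_uniform_measure) auto
qed

lemma AE_unif_Ioo: "AE x in unif. 0 < x \<and> x < (1::real)"
proof -
  have "AE x in lborel. x \<noteq> 0 \<and> x \<noteq> (1::real)"
    using AE_lborel_singleton[of 0] AE_lborel_singleton[of 1] by eventually_elim auto
  then have "AE x in lborel. x \<in> {0..1} \<longrightarrow> 0 < x \<and> x < (1::real)"
    by eventually_elim auto
  then show ?thesis by (intro AE_uniform_measureI) auto
qed

interpretation seeds: prob_space seeds
  unfolding seeds_def by (intro prob_space_PiM prob_space_unif)

lemma product_prob_space_unif: "product_prob_space (\<lambda>_ :: nat. unif)"
proof -
  interpret prob_space unif by (rule prob_space_unif)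
  show ?thesis by unfold_locales
qed

lemma space_seeds [simp]: "space seeds = UNIV"
  by (simp add: seeds_def space_PiM PiE_def extensional_def)

lemma seeds_component [measurable]: "(\<lambda>\<omega>. \<omega> i) \<in> borel_measurable seeds"
proof -
  have "(\<lambda>\<omega>. \<omega> i) \<in> measurable seeds unif"
    unfolding seeds_def by (rule measurable_component_singleton) simp
  then show ?thesis by (simp add: measurable_def)
qed

lemma seeds_below:
  assumes "finite J" "\<And>i. i \<in> J \<Longrightarrow> 0 \<le> y i" "\<And>i. i \<in> J \<Longrightarrow> y i \<le> 1"
  shows "measure seeds {\<omega>. \<forall>i\<in>J. \<omega> i \<le> y i} = (\<Prod>i\<in>J. y i)"
proof -
  have "{\<omega>. \<forall>i\<in>J. \<omega> i \<le> y i} = prod_emb UNIV (\<lambda>_. unif) J (Pi\<^sub>E J (\<lambda>i. {..y i}))"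
    by (auto simp: prod_emb_def PiE_iff)
  then have "measure seeds {\<omega>. \<forall>i\<in>J. \<omega> i \<le> y i} = (\<Prod>i\<in>J. measure unif {..y i})"
    using assms(1) product_prob_space.measure_PiM_emb[OF product_prob_space_unif, of J UNIV]
    by (simp add: seeds_def)
  also have "\<dots> = (\<Prod>i\<in>J. y i)"
    using assms by (intro prod.cong) (auto simp: measure_unif_atMost)
  finally show ?thesis .
qed

lemma indep_seeds: "seeds.indep_vars (\<lambda>_. unif) (\<lambda>i \<omega>. \<omega> i) UNIV"
proof (subst seeds.indep_vars_iff_distr_eq_PiM)
  show "distr seeds (Pi\<^sub>M UNIV (\<lambda>_. unif)) (\<lambda>\<omega>. \<lambda>i\<in>UNIV. \<omega> i) =
    Pi\<^sub>M UNIV (\<lambda>i. distr seeds unif (\<lambda>\<omega>. \<omega> i))"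
    using distr_PiM_component[of "UNIV :: nat set" "\<lambda>_. unif"] prob_space_unif
    by (simp add: restrict_UNIV distr_id2 seeds_def)
qed (simp_all add: measurable_def seeds_def measurable_component_singleton)

text \<open>Sample \<open>l\<close> reads only the seeds in the block \<open>K l\<close>. The blocks
  are disjoint, so the failures of the samples are independent and their probabilities
  multiply.\<close>

lemma seeds_blocks:
  assumes y: "\<And>i. i < d \<Longrightarrow> 0 \<le> y i" "\<And>i. i < d \<Longrightarrow> y i \<le> 1"
  shows "measure seeds {\<omega>. \<forall>l<L. \<not> (\<forall>i<d. \<omega> (l * d + i) \<le> y i)} = (1 - (\<Prod>i<d. y i)) ^ L"
proof (cases "L = 0")
  case True
  then show ?thesis using seeds.prob_space by simp
next
  case False
  define K where "K l = {l * d..<l * d + d}" for l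
  define N where "N l = {\<omega> :: nat \<Rightarrow> real. \<forall>i<d. \<omega> (l * d + i) \<le> y i}" for l
  define A where "A l = {\<omega> \<in> space (Pi\<^sub>M (K l) (\<lambda>_. unif)). \<not> (\<forall>i<d. \<omega> (l * d + i) \<le> y i)}" for l
  have disj: "disjoint_family_on K {..<L}"
    unfolding disjoint_family_on_def
  proof (intro ballI impI)
    fix l k :: nat assume "l \<noteq> k"
    then show "K l \<inter> K k = {}"
    proof (induction l k rule: linorder_wlog)
      case (le l k)
      then have "Suc l * d \<le> k * d" by (intro mult_right_mono) auto
      then show ?case by (auto simp: K_def)
    qed blast
  qed
  have iv: "seeds.indep_vars (\<lambda>l. Pi\<^sub>M (K l) (\<lambda>_. unif)) (\<lambda>l \<omega>. restrict (\<lambda>i. \<omega> i) (K l)) {..<L}"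
    by (rule seeds.indep_vars_restrict[OF indep_seeds _ disj]) auto
  have meas: "A l \<in> sets (Pi\<^sub>M (K l) (\<lambda>_. unif))" for l
  proof -
    have [measurable]: "(\<lambda>\<omega>. \<omega> (l * d + i)) \<in> borel_measurable (Pi\<^sub>M (K l) (\<lambda>_. unif))" if "i < d" for i
    proof -
      have "(\<lambda>\<omega>. \<omega> (l * d + i)) \<in> measurable (Pi\<^sub>M (K l) (\<lambda>_. unif)) unif"
        using that by (intro measurable_component_singleton) (simp add: K_def)
      then show ?thesis by (simp add: measurable_def)
    qed
    have "A l = space (Pi\<^sub>M (K l) (\<lambda>_. unif)) -
        {\<omega> \<in> space (Pi\<^sub>M (K l) (\<lambda>_. unif)). \<forall>i\<in>{..<d}. \<omega> (l * d + i) \<le> y i}"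
      by (auto simp: A_def)
    also have "\<dots> \<in> sets (Pi\<^sub>M (K l) (\<lambda>_. unif))"
      by (intro sets.Diff sets.top sets.sets_Collect_finite_All) (auto intro!: borel_measurable_le)
    finally show ?thesis .
  qed
  have pre: "(\<lambda>\<omega>. restrict (\<lambda>i. \<omega> i) (K l)) -` A l \<inter> space seeds = - N l" for l
    by (auto simp: A_def N_def K_def space_PiM)
  have N: "N l \<in> sets seeds" for l
  proof -
    have "{\<omega> \<in> space seeds. \<forall>i\<in>{..<d}. \<omega> (l * d + i) \<le> y i} \<in> sets seeds" by measurable
    moreover have "{\<omega> \<in> space seeds. \<forall>i\<in>{..<d}. \<omega> (l * d + i) \<le> y i} = N l"
      by (auto simp: N_def)
    ultimately show ?thesis by simp
  qed
  have prob_N: "measure seeds (N l) = (\<Prod>i<d. y i)" for l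
  proof -
    have "N l = {\<omega>. \<forall>k\<in>(\<lambda>i. l * d + i) ` {..<d}. \<omega> k \<le> y (k - l * d)}" by (auto simp: N_def)
    then have "measure seeds (N l) = (\<Prod>k\<in>(\<lambda>i. l * d + i) ` {..<d}. y (k - l * d))"
      using y by (simp only:) (rule seeds_below, auto)
    also have "\<dots> = (\<Prod>i<d. y i)" by (subst prod.reindex) (auto simp: inj_on_def)
    finally show ?thesis .
  qed
  have "{\<omega>. \<forall>l<L. \<not> (\<forall>i<d. \<omega> (l * d + i) \<le> y i)} =
      (\<Inter>l\<in>{..<L}. (\<lambda>\<omega>. restrict (\<lambda>i. \<omega> i) (K l)) -` A l \<inter> space seeds)"
    unfolding pre by (auto simp: N_def)
  also have "measure seeds \<dots> =
      (\<Prod>l<L. measure seeds ((\<lambda>\<omega>. restrict (\<lambda>i. \<omega> i) (K l)) -` A l \<inter> space seeds))"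
    using False meas by (intro seeds.indep_varsD[OF iv]) auto
  also have "\<dots> = (\<Prod>l<L. 1 - (\<Prod>i<d. y i))"
    unfolding pre using N seeds.prob_compl by (simp add: Compl_eq_Diff_UNIV prob_N)
  finally show ?thesis by simp
qed

lemma seeds_Ioo: "AE \<omega> in seeds. \<forall>k. 0 < \<omega> k \<and> \<omega> k < 1"
proof -
  have "AE \<omega> in seeds. 0 < \<omega> k \<and> \<omega> k < 1" for k :: nat
    by (rule AE_PiM_component[of "UNIV :: nat set" "\<lambda>_. unif", folded seeds_def])
      (simp_all only: prob_space_unif AE_unif_Ioo UNIV_I)
  then show ?thesis by (simp add: AE_all_countable)
qed

section \<open>Widths with prescribed tails\<close>

text \<open>The sublevel set is a closed interval from 0 to its supremum \<open>s\<close>: convexity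
  forces at least linear growth beyond a point \<open>z\<close> with \<open>0 < G z\<close>, so the
  set is bounded; scaling \<open>z\<close> down gives a positive element; continuity of
  \<open>G\<close> on the positive reals gives \<open>G s \<le> h\<close>.\<close>

lemma orlicz_sublevel:
  assumes G: "orlicz_function G" and h: "0 < h"
  shows "\<exists>s>0. \<forall>t\<ge>0. t \<le> s \<longleftrightarrow> G t \<le> h"
proof -
  obtain z where z: "0 < z" "0 < G z"
    using G unfolding orlicz_function_def by (metis order_le_less)
  define X where "X = {t. 0 \<le> t \<and> G t \<le> h}"
  have bdd: "bdd_above X"
  proof (rule bdd_aboveI)
    fix t assume t: "t \<in> X"
    show "t \<le> max z (z * h / G z)"
    proof (cases "t \<le> z")
      case False
      then have "G z \<le> (z / t) * G t"
        using orlicz_scale[OF G, of "z / t" t] z by simp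
      also have "\<dots> \<le> (z / t) * h" using t z False by (intro mult_left_mono) (auto simp: X_def)
      finally have "t \<le> z * h / G z" using z False by (simp add: field_simps)
      then show ?thesis by simp
    qed simp
  qed
  define e where "e = min 1 (h / G z)"
  have e: "0 < e" "e \<le> 1" "e \<le> h / G z" using h z by (auto simp: e_def)
  have "G (e * z) \<le> e * G z" using e z by (intro orlicz_scale[OF G]) auto
  also have "\<dots> \<le> h" using e z by (simp add: field_simps)
  finally have eX: "e * z \<in> X" using e z by (simp add: X_def)
  define s where "s = Sup X"
  have "e * z \<le> s" unfolding s_def by (rule cSup_upper[OF eX bdd])
  then have s: "0 < s" using e z mult_pos_pos[of e z] by linarith
  have below: "G t \<le> h" if t: "0 \<le> t" "t < s" for t
  proof -
    obtain x where "x \<in> X" "t < x" using t(2) eX less_cSupD[of X t] unfolding s_def by blast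
    then show ?thesis using orlicz_mono[OF G, of t x] t by (simp add: X_def)
  qed
  have "continuous_on {0<..} G"
  proof (rule convex_on_continuous)
    have "convex_on {0..} G" using G by (simp add: orlicz_function_def)
    then show "convex_on {0<..} G"
      by (rule convex_on_subset) (auto intro: convex_real_interval)
  qed simp
  then have "isCont G s" using s continuous_on_eq_continuous_at[of "{0<..}" G] by auto
  then have "(G \<longlongrightarrow> G s) (at_left s)"
    unfolding isCont_def by (rule filterlim_mono[OF _ order_refl at_le]) simp
  moreover have "eventually (\<lambda>t. G t \<le> h) (at_left s)"
    using s below by (auto simp: eventually_at_left_field intro!: exI[of _ 0])
  ultimately have "G s \<le> h" by (intro tendsto_upperbound) auto
  then have "t \<le> s \<longleftrightarrow> G t \<le> h" if "0 \<le> t" for t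
    using below[OF that] cSup_upper[OF _ bdd, of t] that by (force simp: s_def X_def)
  then show ?thesis using s by blast
qed

text \<open>Inverse transform sampling: for uniform \<open>v\<close> the event
  \<open>t \<le> s\<close> has probability \<open>exp (- lam * G t)\<close>. For \<open>v\<close>
  outside the open unit interval, a null event, the default 1 keeps the width positive, as the
  bounds that hold for every seed require.\<close>

lemma width_exists:
  assumes G: "orlicz_function G" and lam: "0 < lam"
  shows "\<exists>s>0. 0 < v \<and> v < 1 \<longrightarrow> (\<forall>t\<ge>0. t \<le> s \<longleftrightarrow> v \<le> exp (- lam * G t))"
proof (cases "0 < v \<and> v < 1")
  case True
  then have "0 < - ln v / lam" using lam by (intro divide_pos_pos) auto
  then obtain s where s: "0 < s" "\<And>t. 0 \<le> t \<Longrightarrow> t \<le> s \<longleftrightarrow> G t \<le> - ln v / lam"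
    using orlicz_sublevel[OF G] by blast
  have "G t \<le> - ln v / lam \<longleftrightarrow> v \<le> exp (- lam * G t)" for t
  proof -
    have "v \<le> exp (- lam * G t) \<longleftrightarrow> ln v \<le> - lam * G t" using True
      by (metis exp_le_cancel_iff exp_ln)
    then show ?thesis using lam by (auto simp: field_simps)
  qed
  then show ?thesis using s by blast
next
  case False
  then show ?thesis by (intro exI[of _ 1]) auto
qed

text \<open>The bad events are that all samples miss \<open>x\<close>, that some sample captures
  some \<open>y\<close> in \<open>Y\<close>, and that a seed leaves the open unit interval.
  Independence bounds the first, a union bound over \<open>card Y * L\<close> pairs the second, and
  the third is null.\<close>

lemma good_seeds:
  fixes Y :: "(nat \<Rightarrow> real) set" and L :: nat
  assumes G: "orlicz_function G" and lam: "0 < lam"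
    and x: "(\<Sum>i<d. G \<bar>x i\<bar>) \<le> 1"
    and Y: "finite Y" "\<forall>y\<in>Y. \<kappa> \<le> (\<Sum>i<d. G \<bar>y i\<bar>)"
  shows "\<exists>A\<in>sets seeds.
    1 - (1 - exp (- lam)) ^ L - real (card Y) * real L * exp (- lam * \<kappa>) \<le> measure seeds A \<and>
    (\<forall>\<omega>\<in>A. (\<forall>k. 0 < \<omega> k \<and> \<omega> k < 1) \<and>
       (\<exists>l<L. \<forall>i<d. \<omega> (l * d + i) \<le> exp (- lam * G \<bar>x i\<bar>)) \<and>
       (\<forall>l<L. \<forall>y\<in>Y. \<not> (\<forall>i<d. \<omega> (l * d + i) \<le> exp (- lam * G \<bar>y i\<bar>))))"
proof -
  define E where "E x l = {\<omega> :: nat \<Rightarrow> real. \<forall>i<d. \<omega> (l * d + i) \<le> exp (- lam * G \<bar>x i\<bar>)}"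
    for x :: "nat \<Rightarrow> real" and l
  have E_sets: "E x l \<in> sets seeds" for x l
  proof -
    have "{\<omega> \<in> space seeds. \<forall>i\<in>{..<d}. \<omega> (l * d + i) \<le> exp (- lam * G \<bar>x i\<bar>)} \<in> sets seeds"
      by measurable
    moreover have "{\<omega> \<in> space seeds. \<forall>i\<in>{..<d}. \<omega> (l * d + i) \<le> exp (- lam * G \<bar>x i\<bar>)} = E x l"
      by (auto simp: E_def)
    ultimately show ?thesis by simp
  qed
  have exp1: "exp (- lam * G \<bar>t\<bar>) \<le> 1" for t
    using G lam by (auto simp: orlicz_function_def)
  have prod: "(\<Prod>i<d. exp (- lam * G \<bar>x i\<bar>)) = exp (- lam * (\<Sum>i<d. G \<bar>x i\<bar>))" for x :: "nat \<Rightarrow> real"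
    by (simp add: exp_sum[symmetric] sum_distrib_left)
  define Bad where "Bad = {\<omega>. \<forall>l<L. \<omega> \<notin> E x l}"
  have Bad: "Bad \<in> sets seeds"
  proof -
    have "Bad = space seeds - (\<Union>l<L. E x l)" by (auto simp: Bad_def)
    also have "\<dots> \<in> sets seeds" using E_sets by (intro sets.Diff sets.top sets.finite_UN) auto
    finally show ?thesis .
  qed
  have "measure seeds Bad = (1 - exp (- lam * (\<Sum>i<d. G \<bar>x i\<bar>))) ^ L"
    using seeds_blocks[of d "\<lambda>i. exp (- lam * G \<bar>x i\<bar>)" L] exp1 by (simp only: Bad_def E_def prod) simp
  also have "\<dots> \<le> (1 - exp (- lam)) ^ L"
  proof (rule power_mono)
    have "lam * (\<Sum>i<d. G \<bar>x i\<bar>) \<le> lam * 1" using x lam by (intro mult_left_mono) auto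
    then show "1 - exp (- lam * (\<Sum>i<d. G \<bar>x i\<bar>)) \<le> 1 - exp (- lam)" by simp
    have "0 \<le> (\<Sum>i<d. G \<bar>x i\<bar>)" using G by (intro sum_nonneg) (auto simp: orlicz_function_def)
    then show "0 \<le> 1 - exp (- lam * (\<Sum>i<d. G \<bar>x i\<bar>))" using lam by simp
  qed
  finally have m_Bad: "measure seeds Bad \<le> (1 - exp (- lam)) ^ L" .
  define F where "F = (\<Union>(y, l)\<in>Y \<times> {..<L}. E y l)"
  have m_E: "measure seeds (E y l) \<le> exp (- lam * \<kappa>)" if "y \<in> Y" for y l
  proof -
    have "E y l = {\<omega>. \<forall>k\<in>(\<lambda>i. l * d + i) ` {..<d}. \<omega> k \<le> exp (- lam * G \<bar>y (k - l * d)\<bar>)}"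
      by (auto simp: E_def)
    then have "measure seeds (E y l) = (\<Prod>k\<in>(\<lambda>i. l * d + i) ` {..<d}. exp (- lam * G \<bar>y (k - l * d)\<bar>))"
      using exp1 by (simp only:) (rule seeds_below, auto)
    also have "\<dots> = (\<Prod>i<d. exp (- lam * G \<bar>y i\<bar>))" by (subst prod.reindex) (auto simp: inj_on_def)
    also have "\<dots> \<le> exp (- lam * \<kappa>)" unfolding prod using bspec[OF Y(2) that] lam by simp
    finally show ?thesis .
  qed
  have F: "F \<in> sets seeds" unfolding F_def using Y(1) E_sets by auto
  have "measure seeds F \<le> (\<Sum>(y, l)\<in>Y \<times> {..<L}. measure seeds (E y l))"
    unfolding F_def case_prod_unfold using Y(1) E_sets by (intro seeds.finite_measure_subadditive_finite) auto
  also have "\<dots> \<le> (\<Sum>(y, l)\<in>Y \<times> {..<L}. exp (- lam * \<kappa>))"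
    using m_E by (intro sum_mono) auto
  also have "\<dots> = real (card Y) * real L * exp (- lam * \<kappa>)" by (simp add: case_prod_unfold card_cartesian_product)
  finally have m_F: "measure seeds F \<le> real (card Y) * real L * exp (- lam * \<kappa>)" .
  obtain Z where Z: "{\<omega> \<in> space seeds. \<not> (\<forall>k. 0 < \<omega> k \<and> \<omega> k < 1)} \<subseteq> Z"
      "emeasure seeds Z = 0" "Z \<in> sets seeds"
    using seeds_Ioo by (rule AE_E)
  then have Z: "Z \<in> sets seeds" "measure seeds Z = 0" "\<And>\<omega>. \<omega> \<notin> Z \<Longrightarrow> \<forall>k. 0 < \<omega> k \<and> \<omega> k < 1"
    by (auto simp: measure_def)
  define A where "A = space seeds - (Bad \<union> F \<union> Z)"
  have "measure seeds A = 1 - measure seeds (Bad \<union> F \<union> Z)"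
    unfolding A_def using Bad F Z by (intro seeds.prob_compl) auto
  moreover have "measure seeds (Bad \<union> F \<union> Z) \<le> measure seeds Bad + measure seeds F + measure seeds Z"
    using Bad F Z measure_Un_le[of "Bad \<union> F" seeds Z] measure_Un_le[of Bad seeds F] by auto
  ultimately have "1 - (1 - exp (- lam)) ^ L - real (card Y) * real L * exp (- lam * \<kappa>) \<le> measure seeds A"
    using m_Bad m_F Z(2) by linarith
  moreover have "A \<in> sets seeds" unfolding A_def using Bad F Z by (intro sets.compl_sets sets.Un)
  moreover have "(\<forall>k. 0 < \<omega> k \<and> \<omega> k < 1) \<and>
       (\<exists>l<L. \<forall>i<d. \<omega> (l * d + i) \<le> exp (- lam * G \<bar>x i\<bar>)) \<and>
       (\<forall>l<L. \<forall>y\<in>Y. \<not> (\<forall>i<d. \<omega> (l * d + i) \<le> exp (- lam * G \<bar>y i\<bar>)))" if "\<omega> \<in> A" for \<omega>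
    using that Z(3)[of \<omega>] by (auto simp: A_def Bad_def F_def E_def)
  ultimately show ?thesis by blast
qed

section \<open>The data structure\<close>

lemma real_nat_ceiling_le:
  fixes x :: real
  assumes "0 \<le> x"
  shows "real (nat \<lceil>x\<rceil>) \<le> x + 1"
  using assms of_int_ceiling_le_add_one[of x] by simp

section \<open>Combining the trees of all samples\<close>

text \<open>The trees are chained by \<open>Orelse\<close>. If a tree fails, no point is near for
  its widths, so the sample that captures the near point is among the remaining ones. The tree that
  answers may belong to another sample, hence the existential over \<open>l\<close> in the
  conclusion.\<close>

lemma search_family:
  fixes pt :: "nat \<Rightarrow> nat \<Rightarrow> real" and u :: "nat \<Rightarrow> nat \<Rightarrow> real"
  assumes u: "\<forall>l<L. \<forall>i<d. 0 < u l i" and d: "0 < d" and n: "0 < n"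
    and rho: "1 < \<rho>" and J: "(1 / 2) powr (\<rho> ^ J) \<le> 1 / (4 * real d)"
  shows "\<exists>S. wf_search d n S \<and> nodes S \<le> real L * ((4 * real d + 2) * (2 * n powr \<rho>)) + 1 \<and>
    (\<forall>q. cost q S \<le> real L * (6 * real d * (1 + ln n))) \<and>
    (\<forall>q. \<exists>j<n. eval q S = Some j \<and>
       ((\<exists>l<L. \<exists>k<n. \<forall>i<d. \<bar>pt k i - q i\<bar> \<le> u l i) \<longrightarrow>
        (\<exists>l<L. \<forall>i<d. \<bar>pt j i - q i\<bar> \<le> (4 * real J + 2) * u l i)))"
  using u
proof (induction L)
  case 0
  \<comment> \<open>\<open>Found 0\<close> closes the chain, so a query without near point is
    answered too.\<close>
  then show ?case using n by (intro exI[of _ "Found 0"]) simp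
next
  case (Suc L)
  have uL: "\<forall>i<d. 0 < u L i" using Suc.prems by blast
  have "\<forall>l<L. \<forall>i<d. 0 < u l i" using Suc.prems by simp
  then obtain S where S: "wf_search d n S" "nodes S \<le> real L * ((4 * real d + 2) * (2 * n powr \<rho>)) + 1"
    "\<And>q. cost q S \<le> real L * (6 * real d * (1 + ln n))"
    "\<And>q. \<exists>j<n. eval q S = Some j \<and>
       ((\<exists>l<L. \<exists>k<n. \<forall>i<d. \<bar>pt k i - q i\<bar> \<le> u l i) \<longrightarrow>
        (\<exists>l<L. \<forall>i<d. \<bar>pt j i - q i\<bar> \<le> (4 * real J + 2) * u l i))"
    using Suc.IH by blast
  have "{..<n} \<noteq> {}" using n by auto
  then obtain T where T: "wf_search d n T" "solves d pt (u L) (4 * real J + 2) {..<n} T"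
    "nodes T \<le> (4 * real d + 2) * (2 * n powr \<rho> - 1)"
    "\<And>q. cost q T \<le> 6 * real d * (1 + ln n)"
    using search_tree[OF finite_lessThan subset_refl uL d rho J, of n pt]
    by (auto split: if_splits)
  have "(4 * real d + 2) * (2 * n powr \<rho> - 1) \<le> (4 * real d + 2) * (2 * n powr \<rho>)"
    by (intro mult_left_mono) auto
  then have "nodes (Orelse T S) \<le> real (Suc L) * ((4 * real d + 2) * (2 * n powr \<rho>)) + 1"
    using S(2) T(3) by (simp only: nodes.simps of_nat_add of_nat_Suc distrib_right) simp
  moreover have "cost q (Orelse T S) \<le> real (Suc L) * (6 * real d * (1 + ln n))" for q
    using S(3)[of q] T(4)[of q] by (simp add: distrib_right)
  moreover have "\<exists>j<n. eval q (Orelse T S) = Some j \<and>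
       ((\<exists>l<Suc L. \<exists>k<n. \<forall>i<d. \<bar>pt k i - q i\<bar> \<le> u l i) \<longrightarrow>
        (\<exists>l<Suc L. \<forall>i<d. \<bar>pt j i - q i\<bar> \<le> (4 * real J + 2) * u l i))" for q
  proof (cases "eval q T")
    case None
    then have "\<not> (\<forall>i<d. \<bar>pt k i - q i\<bar> \<le> u L i)" if "k < n" for k
      using T(2)[unfolded solves_def, rule_format, of q] that by (auto simp: not_le)
    then have "(\<exists>l<Suc L. \<exists>k<n. \<forall>i<d. \<bar>pt k i - q i\<bar> \<le> u l i) \<longleftrightarrow>
        (\<exists>l<L. \<exists>k<n. \<forall>i<d. \<bar>pt k i - q i\<bar> \<le> u l i)"
      unfolding less_Suc_eq by blast
    then show ?thesis using None S(4)[of q] less_SucI by (simp only: eval.simps option.case) blast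
  next
    case (Some j)
    then have "j < n" "\<forall>i<d. \<bar>pt j i - q i\<bar> \<le> (4 * real J + 2) * u L i"
      using T(2)[unfolded solves_def, rule_format, of q] by auto
    then show ?thesis using Some by auto
  qed
  ultimately show ?case using S(1) T(1) by (intro exI[of _ "Orelse T S"]) (simp only: wf_search.simps simp_thms)
qed

text \<open>Each node takes three words and three reals, which gives \<open>6 * B\<close>; the
  points take \<open>n * d\<close> further cells.\<close>

lemma memory_exists:
  fixes u :: "nat \<Rightarrow> nat \<Rightarrow> real" and L J d n b :: nat and \<rho> B :: real
  assumes B_def: "B = real L * ((4 * real d + 2) * (2 * n powr \<rho>)) + 1"
    and P: "P \<subseteq> points d" "finite P" "card P = n"
    and u: "\<forall>l<L. \<forall>i<d. 0 < u l i" and d: "0 < d" and n: "0 < n"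
    and rho: "1 < \<rho>" and J: "(1 / 2) powr (\<rho> ^ J) \<le> 1 / (4 * real d)"
    and b: "3 * B + n * d + d < 2 ^ b"
  shows "\<exists>m. length (fst m) + length (snd m) \<le> 6 * B + n * d \<and> (\<forall>v\<in>set (fst m). v < 2 ^ b) \<and>
    (\<forall>q. \<exists>t p. t \<le> 9 * (real L * (6 * real d * (1 + ln n))) + 6 \<and>
       answers (walk d) b d m q t p \<and> p \<in> P \<and>
       ((\<exists>l<L. \<exists>x\<in>P. \<forall>i<d. \<bar>x i - q i\<bar> \<le> u l i) \<longrightarrow>
        (\<exists>l<L. \<forall>i<d. \<bar>p i - q i\<bar> \<le> (4 * real J + 2) * u l i)))"
proof -
  obtain pt where pt: "bij_betw pt {0..<n} P"
    using ex_bij_betw_nat_finite[OF P(2)] P(3) by blast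
  then have pt_P: "pt j \<in> P" if "j < n" for j using that by (auto simp: bij_betw_def)
  obtain S where S: "wf_search d n S" "nodes S \<le> B"
    "\<And>q. cost q S \<le> real L * (6 * real d * (1 + ln n))"
    "\<And>q. \<exists>j<n. eval q S = Some j \<and>
       ((\<exists>l<L. \<exists>k<n. \<forall>i<d. \<bar>pt k i - q i\<bar> \<le> u l i) \<longrightarrow>
        (\<exists>l<L. \<forall>i<d. \<bar>pt j i - q i\<bar> \<le> (4 * real J + 2) * u l i))"
    using search_family[OF u d n rho J, of pt] unfolding B_def by blast
  define m where "m = layout d n pt (compile 0 0 S)"
  have "real (3 * nodes S + n * d + d) \<le> 3 * B + n * d + d" using S(2) by simp
  also have "\<dots> < real (2 ^ b)" using b by simp
  finally have bb: "3 * nodes S + n * d + d < 2 ^ b" by (simp only: of_nat_less_iff)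
  have "length (fst m) + length (snd m) \<le> 6 * B + n * d"
    using S(2) by (simp add: m_def layout_def)
  moreover have "\<forall>v\<in>set (fst m). v < 2 ^ b"
    using layout_words[OF S(1) d] bb unfolding m_def by (meson le_less_trans)
  moreover have "\<exists>t p. t \<le> 9 * (real L * (6 * real d * (1 + ln n))) + 6 \<and>
       answers (walk d) b d m q t p \<and> p \<in> P \<and>
       ((\<exists>l<L. \<exists>x\<in>P. \<forall>i<d. \<bar>x i - q i\<bar> \<le> u l i) \<longrightarrow>
        (\<exists>l<L. \<forall>i<d. \<bar>p i - q i\<bar> \<le> (4 * real J + 2) * u l i))" for q
  proof -
    obtain j where j: "j < n" "eval q S = Some j" 
       "(\<exists>l<L. \<exists>k<n. \<forall>i<d. \<bar>pt k i - q i\<bar> \<le> u l i) \<longrightarrow>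
        (\<exists>l<L. \<forall>i<d. \<bar>pt j i - q i\<bar> \<le> (4 * real J + 2) * u l i)"
      using S(4) by blast
    have "3 * nodes S < 2 ^ b" "d < 2 ^ b" using bb by linarith+
    moreover have "\<forall>j<n. pt j \<in> points d" using pt_P P(1) by blast
    ultimately obtain t where t: "t \<le> 9 * cost q S + 6" "answers (walk d) b d m q t (pt j)"
      using answers_search[OF S(1) d j(2), of b pt] unfolding m_def by blast
    have "real t \<le> 9 * real (cost q S) + 6" using t(1) by linarith
    then have "t \<le> 9 * (real L * (6 * real d * (1 + ln n))) + 6" using S(3)[of q] by linarith
    moreover have "(\<exists>l<L. \<exists>x\<in>P. \<forall>i<d. \<bar>x i - q i\<bar> \<le> u l i) \<longrightarrow>
        (\<exists>l<L. \<forall>i<d. \<bar>pt j i - q i\<bar> \<le> (4 * real J + 2) * u l i)"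
    proof
      assume "\<exists>l<L. \<exists>x\<in>P. \<forall>i<d. \<bar>x i - q i\<bar> \<le> u l i"
      then obtain l x where l: "l < L" "x \<in> P" "\<forall>i<d. \<bar>x i - q i\<bar> \<le> u l i" by blast
      then obtain k where "k < n" "x = pt k" using pt by (auto simp: bij_betw_def)
      then show "\<exists>l<L. \<forall>i<d. \<bar>pt j i - q i\<bar> \<le> (4 * real J + 2) * u l i" using l j(3) by blast
    qed
    ultimately show ?thesis using t(2) pt_P[OF j(1)] by blast
  qed
  ultimately show ?thesis by blast
qed

section \<open>Far points and the choice of parameters\<close>

text \<open>At scale \<open>\<kappa> * s\<close> the sum exceeds 1, and by convexity passing from
  scale \<open>s\<close> to \<open>\<kappa> * s\<close> divides each term by at least
  \<open>\<kappa>\<close>.\<close>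

lemma orlicz_far:
  assumes G: "orlicz_function G" and s: "0 < s" and k: "1 \<le> \<kappa>" and far: "\<kappa> * s < orlicz_norm d G x"
  shows "\<kappa> \<le> (\<Sum>i<d. G \<bar>x i / s\<bar>)"
proof -
  have "\<not> orlicz_norm d G x \<le> \<kappa> * s" using far by simp
  then have "1 < (\<Sum>i<d. G \<bar>x i / (\<kappa> * s)\<bar>)"
    using orlicz_norm_le_iff[OF G, of "\<kappa> * s" d x] s k by (simp add: orlicz_ball_def)
  also have "\<dots> \<le> (\<Sum>i<d. (1 / \<kappa>) * G \<bar>x i / s\<bar>)"
  proof (intro sum_mono)
    fix i
    have "G \<bar>x i / (\<kappa> * s)\<bar> = G ((1 / \<kappa>) * \<bar>x i / s\<bar>)" using k s by (simp add: abs_mult abs_divide)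
    also have "\<dots> \<le> (1 / \<kappa>) * G \<bar>x i / s\<bar>" using k by (intro orlicz_scale[OF G]) auto
    finally show "G \<bar>x i / (\<kappa> * s)\<bar> \<le> (1 / \<kappa>) * G \<bar>x i / s\<bar>" .
  qed
  also have "\<dots> = (\<Sum>i<d. G \<bar>x i / s\<bar>) / \<kappa>" by (simp add: sum_divide_distrib)
  finally show ?thesis using k by (simp add: field_simps)
qed

text \<open>For \<open>d\<close> at most 2 the left side is at most 2 and the maximum with 1
  suffices. Otherwise \<open>ln d\<close> is at least 1, so \<open>log 2 (4 d)\<close> is at most
  \<open>4 * ln d\<close>, and \<open>ln 4\<close> is at most 2.\<close>

lemma ln_log_dim:
  assumes "1 \<le> d"
  shows "ln (log 2 (4 * real d)) \<le> 3 * max 1 (ln (ln (real d)))"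
proof -
  have log: "log 2 (4 * real d) = 2 + log 2 (real d)"
    using assms log_of_power_eq[of 4 2 2] by (simp add: log_mult)
  show ?thesis
  proof (cases "d \<le> 2")
    case True
    then have "log 2 (real d) \<le> log 2 2" using assms by (subst log_le_cancel_iff) auto
    moreover have "0 \<le> log 2 (real d)" using assms by simp
    ultimately have "ln (log 2 (4 * real d)) \<le> 2" 
      unfolding log using ln_le_minus_one[of "2 + log 2 (real d)"] by simp
    then show ?thesis by linarith
  next
    case False
    have "exp 1 \<le> real d" using exp_le False by linarith
    then have ln_d: "1 \<le> ln (real d)" using assms by (subst ln_ge_iff) auto
    have "ln (real d) \<le> ln (real d) * (3 / 2 * ln 2)"
      using ln2_ge_two_thirds ln_d mult_left_mono[of 1 "3 / 2 * ln 2" "ln (real d)"] by simp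
    then have "log 2 (real d) \<le> 3 / 2 * ln (real d)"
      unfolding log_def by (simp add: field_simps)
    then have "log 2 (4 * real d) \<le> 4 * ln (real d)" using ln_d log by linarith
    moreover have "0 < log 2 (4 * real d)" using assms log by (simp add: add_pos_nonneg)
    ultimately have "ln (log 2 (4 * real d)) \<le> ln (4 * ln (real d))"
      by (subst ln_le_cancel_iff) auto
    also have "\<dots> = ln (2 ^ 2) + ln (ln (real d))" using ln_d by (subst ln_mult) auto
    also have "ln (2 ^ 2 :: real) \<le> 2" using ln_2_less_1 by (subst ln_realpow) auto
    finally show ?thesis by linarith
  qed
qed

lemma half_powr_power_le:
  assumes d: "1 \<le> d" and rho: "1 < \<rho>" and J: "log \<rho> (log 2 (4 * real d)) \<le> real J"
  shows "(1 / 2) powr (\<rho> ^ J) \<le> 1 / (4 * real d)"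
proof -
  have "0 < log 2 (4 * real d)" using d by simp
  then have "log 2 (4 * real d) = \<rho> powr log \<rho> (log 2 (4 * real d))" using rho by simp
  also have "\<dots> \<le> \<rho> powr J" using J rho by (intro powr_mono) auto
  also have "\<dots> = \<rho> ^ J" using rho by (simp add: powr_realpow)
  finally have "2 powr log 2 (4 * real d) \<le> 2 powr (\<rho> ^ J)" by (intro powr_mono) auto
  then have "4 * real d \<le> 2 powr (\<rho> ^ J)" using d by simp
  then have "1 / (2 powr (\<rho> ^ J)) \<le> 1 / (4 * real d)" using d by (intro divide_left_mono) auto
  then show ?thesis by (simp add: powr_divide)
qed

text \<open>Each kind of failure has probability at most 1/6. Missing the near point: at most
  \<open>exp (- 2)\<close>, as \<open>L\<close> is at least \<open>2 * exp lam\<close>. Capturing a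
  far point: \<open>L\<close> is at most \<open>3 * exp lam\<close>, and the factor
  \<open>exp (- lam / eta)\<close> equals \<open>1 / (18 n)\<close>, where 18 is 3 times 6.\<close>

lemma failure_bound:
  fixes n L :: nat and eta :: real
  assumes eta: "0 < eta" and n: "1 \<le> n"
    and lam: "lam = eta * ln (18 * real n)" and L: "L = nat \<lceil>2 * exp lam\<rceil>"
    and k: "k \<le> n"
  shows "2 / 3 \<le> 1 - (1 - exp (- lam)) ^ L - real k * real L * exp (- lam * (1 + 1 / eta))"
proof -
  have lam_pos: "0 < lam" using n eta by (simp add: lam)
  have L2: "2 * exp lam \<le> L" unfolding L by (simp add: real_nat_ceiling_ge)
  have "real L \<le> 2 * exp lam + 1" unfolding L by (rule real_nat_ceiling_le) simp
  also have "\<dots> \<le> 3 * exp lam" using lam_pos by simp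
  finally have L3: "real L \<le> 3 * exp lam" .
  have "(1 - exp (- lam)) ^ L \<le> exp (- exp (- lam)) ^ L"
    using exp_ge_add_one_self[of "- exp (- lam)"] lam_pos by (intro power_mono) auto
  also have "\<dots> = exp (- (real L * exp (- lam)))" by (simp add: exp_of_nat_mult[symmetric])
  also have "\<dots> \<le> exp (- 2)"
  proof -
    have "2 = 2 * exp lam * exp (- lam)" by (simp add: exp_minus)
    also have "\<dots> \<le> real L * exp (- lam)" using L2 by (intro mult_right_mono) auto
    finally show ?thesis by simp
  qed
  also have "exp (- 2 :: real) \<le> 1 / 6"
  proof -
    have "5 / 2 \<le> exp (1 :: real)" using exp_lower_Taylor_quadratic[of 1] by simp
    then have "(5 / 2)\<^sup>2 \<le> (exp (1 :: real))\<^sup>2" by (intro power_mono) auto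
    also have "\<dots> = exp (2 :: real)" by (simp add: exp_double[symmetric])
    finally have "6 \<le> exp (2 :: real)" by (simp add: power2_eq_square)
    then show ?thesis by (simp add: exp_minus field_simps)
  qed
  finally have 1: "(1 - exp (- lam)) ^ L \<le> 1 / 6" .
  have "lam * (1 / eta) = ln (18 * real n)" using eta by (simp add: lam)
  then have "- lam * (1 + 1 / eta) = - lam - ln (18 * real n)" by (simp add: distrib_left)
  then have e: "exp (- lam * (1 + 1 / eta)) = exp (- lam) / (18 * real n)"
    using n by (simp add: exp_diff)
  have "real k * real L * exp (- lam * (1 + 1 / eta)) \<le> n * (3 * exp lam) * exp (- lam * (1 + 1 / eta))"
    using mult_mono[of "real k" "real n" "real L" "3 * exp lam"] L3 k by (intro mult_right_mono) auto
  also have "\<dots> = 1 / 6" unfolding e using n by (simp add: exp_minus field_simps)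
  finally show ?thesis using 1 by linarith
qed

text \<open>The exponent is spent in two halves: the number of samples is at most
  \<open>54 * n powr eta\<close>, and a tree has size of order \<open>d * n powr (1 + eta)\<close>.
  For the time, the second half absorbs the factor \<open>1 + ln n\<close>, at the price of
  \<open>1 / eta\<close> in the constant.\<close>

lemma resource_bounds:
  fixes n d L b :: nat and \<epsilon> eta lam B K :: real
  assumes eps: "0 < \<epsilon>" "\<epsilon> < 1 / 2" and eta: "eta = \<epsilon> / 2" and d: "1 \<le> d" and n: "1 \<le> n"
    and lam: "lam = eta * ln (18 * real n)" and L: "L = nat \<lceil>2 * exp lam\<rceil>"
    and b: "b = nat \<lceil>13 * log 2 (real d * real n + 1)\<rceil>"
    and K: "K = 4000 * (1 + 2 / \<epsilon>)"
    and B: "B = real L * ((4 * real d + 2) * (2 * n powr (1 + eta))) + 1"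
  shows "3 * B + n * d + d < 2 ^ b"
    and "6 * B + n * d + 13 \<le> K * (real d * real n powr (1 + \<epsilon>))"
    and "9 * (real L * (6 * real d * (1 + ln n))) + 6 \<le> K * (real d * real n powr \<epsilon>)"
    and "real b \<le> K * log 2 (real d * real n + 1)"
proof -
  have n1: "1 \<le> real n" and d1: "1 \<le> real d" using n d by auto
  define N where "N = real n powr eta"
  have N1: "1 \<le> N" using n1 eps by (auto simp: N_def eta intro: ge_one_powr_ge_zero)
  have NN: "N * N = n powr \<epsilon>" by (simp add: N_def eta powr_add[symmetric])
  have lam_pos: "0 < lam" using n eps by (simp add: lam eta)
  have "exp lam = (18 * real n) powr eta" using n by (simp add: lam powr_def)
  also have "\<dots> = 18 powr eta * N" by (simp add: powr_mult N_def)
  also have "\<dots> \<le> 18 powr 1 * N" using eps N1 by (intro mult_right_mono powr_mono) (auto simp: eta)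
  finally have "exp lam \<le> 18 * N" by simp
  moreover have "real L \<le> 2 * exp lam + 1" unfolding L by (rule real_nat_ceiling_le) simp
  moreover have "1 \<le> exp lam" using lam_pos by simp
  ultimately have L54: "real L \<le> 54 * N" by linarith
  have K4: "4000 \<le> K" using eps by (simp add: K)
  define X where "X = real d * n powr (1 + \<epsilon>)"
  have nX: "real n \<le> n powr (1 + \<epsilon>)" using powr_mono[of 1 "1 + \<epsilon>" "real n"] n1 eps by simp
  have nd: "real n * real d \<le> X" using mult_left_mono[OF nX, of "real d"] by (simp add: X_def mult.commute)
  moreover have "1 * real d \<le> real n * real d" "1 * 1 \<le> real n * real d"
    using n1 d1 by (intro mult_mono; simp)+
  ultimately have X: "real n * real d \<le> X" "real d \<le> X" "1 \<le> X" by auto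
  have "eta + (1 + eta) = 1 + \<epsilon>" by (simp add: eta)
  then have "N * n powr (1 + eta) = n powr (1 + \<epsilon>)" by (simp only: N_def powr_add[symmetric])
  then have X_eq: "X = real d * (N * n powr (1 + eta))" by (simp add: X_def)
  have "B \<le> 54 * N * ((6 * real d) * (2 * n powr (1 + eta))) + 1"
    unfolding B using L54 d1 N1 by (intro add_mono mult_mono) auto
  also have "\<dots> = 648 * X + 1" by (simp add: X_eq)
  finally have BX: "B \<le> 649 * X" using X by linarith
  have "6 * B + n * d + 13 \<le> 4000 * X" using BX X by simp
  also have "\<dots> \<le> K * X" using K4 X by (intro mult_right_mono) auto
  finally show "6 * B + n * d + 13 \<le> K * (real d * real n powr (1 + \<epsilon>))" by (simp add: X_def)
  define z where "z = real d * real n + 1"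
  have z: "2 \<le> z" using \<open>1 * 1 \<le> real n * real d\<close> by (simp add: z_def mult.commute)
  have "n powr (1 + \<epsilon>) \<le> n powr 2" using n1 eps by (intro powr_mono) auto
  then have "X \<le> real d * (real n)\<^sup>2" using n by (simp add: X_def powr_numeral mult_left_mono)
  also have "\<dots> \<le> (real d * real n)\<^sup>2"
    using d1 mult_right_mono[of "real d" "real d ^ 2" "(real n)\<^sup>2"] self_le_power[of "real d" 2]
    by (simp add: power_mult_distrib)
  also have "\<dots> \<le> z ^ 2" unfolding z_def by (intro power_mono) auto
  finally have Xz: "X \<le> z ^ 2" .
  \<comment> \<open>The 13 in \<open>b\<close> is 11 + 2: \<open>2 ^ 11\<close> covers the constant
    2000, and \<open>X\<close> is at most \<open>z ^ 2\<close>.\<close>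
  have "3 * B + n * d + d \<le> 2000 * X" using BX X by simp
  also have "\<dots> < 2 ^ 11 * X" using X by simp
  also have "\<dots> \<le> z ^ 11 * z ^ 2" using z Xz X by (intro mult_mono power_mono) auto
  also have "\<dots> = z powr 13" using z by (simp add: power_add[symmetric] powr_numeral)
  also have "\<dots> = 2 powr (13 * log 2 z)"
    using z by (simp add: powr_powr[symmetric] mult.commute[of 13])
  also have "\<dots> \<le> 2 powr b" unfolding b z_def by (intro powr_mono real_nat_ceiling_ge) simp
  also have "\<dots> = 2 ^ b" by (simp add: powr_realpow)
  finally show "3 * B + n * d + d < 2 ^ b" .
  have log1: "1 \<le> log 2 z" using z by (simp add: le_log_iff)
  have "real b \<le> 13 * log 2 z + 1" unfolding b z_def[symmetric] using log1 by (intro real_nat_ceiling_le) simp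
  also have "\<dots> \<le> 14 * log 2 z" using log1 by simp
  also have "\<dots> \<le> K * log 2 z" using K4 log1 by (intro mult_right_mono) auto
  finally show "real b \<le> K * log 2 (real d * real n + 1)" by (simp add: z_def)
  have "ln n \<le> N / eta" unfolding N_def using n1 eps by (intro ln_powr_bound) (auto simp: eta)
  then have ln: "1 + ln n \<le> (1 + 2 / \<epsilon>) * N" using N1 eps by (simp add: eta algebra_simps)
  define Y where "Y = real d * real n powr \<epsilon>"
  have "1 * 1 \<le> real d * n powr \<epsilon>"
    using d1 n1 eps by (intro mult_mono) (auto intro: ge_one_powr_ge_zero)
  then have Y: "1 \<le> Y" by (simp add: Y_def)
  have "real L * (6 * real d * (1 + ln n)) \<le> 54 * N * (6 * real d * ((1 + 2 / \<epsilon>) * N))"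
    using L54 ln N1 n1 by (intro mult_mono) auto
  also have "\<dots> = 324 * ((1 + 2 / \<epsilon>) * Y)" by (simp add: Y_def NN[symmetric])
  finally have "9 * (real L * (6 * real d * (1 + ln n))) + 6 \<le> 2916 * ((1 + 2 / \<epsilon>) * Y) + 6" by linarith
  also have "\<dots> \<le> 4000 * ((1 + 2 / \<epsilon>) * Y)"
  proof -
    have "1 * 1 \<le> (1 + 2 / \<epsilon>) * Y" using eps Y by (intro mult_mono) auto
    then show ?thesis by linarith
  qed
  finally show "9 * (real L * (6 * real d * (1 + ln n))) + 6 \<le> K * (real d * real n powr \<epsilon>)"
    by (simp only: K Y_def mult.assoc)
qed


text \<open>One factor \<open>1 / \<epsilon>\<close> comes from \<open>J\<close>, since
  \<open>ln (1 + \<epsilon> / 2)\<close> is at least \<open>\<epsilon> / 4\<close>, and the other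
  from \<open>1 + 2 / \<epsilon>\<close>, which is at most \<open>3 / \<epsilon>\<close>. The
  constant is 51 times 3.\<close>

lemma approximation_bound:
  fixes \<epsilon> :: real
  assumes eps: "0 < \<epsilon>" "\<epsilon> < 1 / 2" and d: "1 \<le> d"
    and J: "J = nat \<lceil>log (1 + \<epsilon> / 2) (log 2 (4 * real d))\<rceil>"
  shows "(4 * real J + 2) * (1 + 2 / \<epsilon>) \<le> 153 * (max 1 (ln (ln (real d))) / \<epsilon>\<^sup>2)"
proof -
  define \<Lambda> where "\<Lambda> = max 1 (ln (ln (real d)))"
  have Lam: "1 \<le> \<Lambda>" by (simp add: \<Lambda>_def)
  have "\<epsilon> / 4 \<le> \<epsilon> / 2 - (\<epsilon> / 2)\<^sup>2" using eps by (simp add: power2_eq_square)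
  also have "\<dots> \<le> ln (1 + \<epsilon> / 2)" using eps by (intro ln_one_plus_pos_lower_bound) auto
  finally have ln_rho: "\<epsilon> / 4 \<le> ln (1 + \<epsilon> / 2)" .
  have "log 2 4 \<le> log 2 (4 * real d)" using d by (subst log_le_cancel_iff) auto
  moreover have "log 2 4 = (2 :: real)" using log_of_power_eq[of 4 2 2] by simp
  ultimately have "2 \<le> log 2 (4 * real d)" by simp
  then have ln_log: "0 \<le> ln (log 2 (4 * real d))" by simp
  then have "log (1 + \<epsilon> / 2) (log 2 (4 * real d)) \<le> ln (log 2 (4 * real d)) / (\<epsilon> / 4)"
    unfolding log_def[of "1 + \<epsilon> / 2"] using ln_rho eps by (intro divide_left_mono) auto
  also have "\<dots> \<le> 3 * \<Lambda> / (\<epsilon> / 4)"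
    unfolding \<Lambda>_def using ln_log_dim[OF d] eps by (intro divide_right_mono) auto
  finally have le: "log (1 + \<epsilon> / 2) (log 2 (4 * real d)) \<le> 12 * \<Lambda> / \<epsilon>" by simp
  have "real J \<le> log (1 + \<epsilon> / 2) (log 2 (4 * real d)) + 1"
    unfolding J using eps ln_log ln_rho by (intro real_nat_ceiling_le) (simp add: log_def[of "1 + \<epsilon> / 2"])
  then have JL: "real J \<le> 12 * \<Lambda> / \<epsilon> + 1" using le by linarith
  have "2 * 1 \<le> (1 / \<epsilon>) * \<Lambda>" using eps Lam by (intro mult_mono) (auto simp: field_simps)
  then have "2 \<le> \<Lambda> / \<epsilon>" by simp
  moreover have "4 * real J + 2 \<le> 48 * (\<Lambda> / \<epsilon>) + 6" using JL by simp
  ultimately have "4 * real J + 2 \<le> 51 * (\<Lambda> / \<epsilon>)" by linarith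
  moreover have "1 + 2 / \<epsilon> \<le> 3 / \<epsilon>" using eps by (simp add: field_simps)
  ultimately have "(4 * real J + 2) * (1 + 2 / \<epsilon>) \<le> 51 * (\<Lambda> / \<epsilon>) * (3 / \<epsilon>)"
    using eps Lam by (intro mult_mono) auto
  then show ?thesis by (simp add: \<Lambda>_def power2_eq_square)
qed

theorem theorem3p2:
  shows "\<exists>C>0. \<forall>\<epsilon>::real. 0 < \<epsilon> \<and> \<epsilon> < 1 / 2 \<longrightarrow>
    (\<exists>K>0. \<forall>(d::nat) (G::real \<Rightarrow> real). 1 \<le> d \<and> orlicz_function G \<longrightarrow>
      (\<exists>c prog pre (b::nat \<Rightarrow> nat).
         1 < c \<and> c \<le> C * (max 1 (ln (ln (real d))) / \<epsilon>\<^sup>2) \<and>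
         (\<forall>n\<ge>1.
            real (b n) \<le> K * log 2 (real d * real n + 1) \<and>
            ann_data_structure d (orlicz_norm d G) c n prog pre (b n)
              (K * (real d * real n powr (1 + \<epsilon>)))
              (K * (real d * real n powr \<epsilon>)))))"
proof (rule exI[of _ 153], intro conjI allI impI)
  fix \<epsilon> :: real assume "0 < \<epsilon> \<and> \<epsilon> < 1 / 2"
  then have eps: "0 < \<epsilon>" "\<epsilon> < 1 / 2" by auto
  define K where "K = 4000 * (1 + 2 / \<epsilon>)"
  show "\<exists>K>0. \<forall>(d::nat) (G::real \<Rightarrow> real). 1 \<le> d \<and> orlicz_function G \<longrightarrow>
      (\<exists>c prog pre (b::nat \<Rightarrow> nat).
         1 < c \<and> c \<le> 153 * (max 1 (ln (ln (real d))) / \<epsilon>\<^sup>2) \<and>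
         (\<forall>n\<ge>1.
            real (b n) \<le> K * log 2 (real d * real n + 1) \<and>
            ann_data_structure d (orlicz_norm d G) c n prog pre (b n)
              (K * (real d * real n powr (1 + \<epsilon>)))
              (K * (real d * real n powr \<epsilon>))))"
  proof (rule exI[of _ K], intro conjI allI impI)
    show "0 < K" using eps by (simp add: K_def add_pos_pos)
    fix d :: nat and G :: "real \<Rightarrow> real"
    assume "1 \<le> d \<and> orlicz_function G"
    then have d: "1 \<le> d" and G: "orlicz_function G" by auto
    define \<rho> where "\<rho> = 1 + \<epsilon> / 2"
    have rho: "1 < \<rho>" using eps by (simp add: \<rho>_def)
    define J where "J = nat \<lceil>log \<rho> (log 2 (4 * real d))\<rceil>"
    have J: "(1 / 2) powr (\<rho> ^ J) \<le> 1 / (4 * real d)"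
      by (rule half_powr_power_le[OF d rho]) (simp add: J_def real_nat_ceiling_ge)
    define D where "D = 4 * real J + 2"
    have D: "2 \<le> D" by (simp add: D_def)
    define \<kappa> where "\<kappa> = 1 + 2 / \<epsilon>"
    have k: "1 < \<kappa>" using eps by (simp add: \<kappa>_def)
    define lam where "lam n = \<epsilon> / 2 * ln (18 * real n)" for n :: nat
    define L where "L n = nat \<lceil>2 * exp (lam n)\<rceil>" for n
    define b where "b n = nat \<lceil>13 * log 2 (real d * real n + 1)\<rceil>" for n :: nat
    define B where "B n = real (L n) * ((4 * real d + 2) * (2 * real n powr \<rho>)) + 1" for n
    note res = resource_bounds[OF eps refl d _ lam_def L_def b_def K_def B_def[unfolded \<rho>_def]]
    \<comment> \<open>The guard \<open>1 \<le> n\<close> secures \<open>0 < lam n\<close>, so that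
      \<open>width_exists\<close> applies.\<close>
    have "\<exists>w. \<forall>n v. 1 \<le> n \<longrightarrow> 0 < w n v \<and>
        (0 < v \<and> v < 1 \<longrightarrow> (\<forall>t\<ge>0. t \<le> w n v \<longleftrightarrow> v \<le> exp (- lam n * G t)))"
    proof -
      have "\<exists>s. 1 \<le> n \<longrightarrow> 0 < s \<and> (0 < v \<and> v < 1 \<longrightarrow> (\<forall>t\<ge>0. t \<le> s \<longleftrightarrow> v \<le> exp (- lam n * G t)))"
        for n v using width_exists[OF G, of "lam n" v] eps by (auto simp: lam_def)
      then show ?thesis by metis
    qed
    then obtain w where w: "\<And>n v. 1 \<le> n \<Longrightarrow> 0 < w n v"
        "\<And>n v t. 1 \<le> n \<Longrightarrow> 0 < v \<Longrightarrow> v < 1 \<Longrightarrow> 0 \<le> t \<Longrightarrow> t \<le> w n v \<longleftrightarrow> v \<le> exp (- lam n * G t)"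
      by metis
    define u where "u n r \<omega> l i = r * w n (\<omega> (l * d + i))" for n r \<omega> and l i :: nat
    define good where "good P r \<omega> m \<longleftrightarrow>
        length (fst m) + length (snd m) \<le> 6 * B (card P) + card P * d \<and>
        (\<forall>v\<in>set (fst m). v < 2 ^ b (card P)) \<and>
        (\<forall>q. \<exists>t p. t \<le> 9 * (real (L (card P)) * (6 * real d * (1 + ln (card P)))) + 6 \<and>
           answers (walk d) (b (card P)) d m q t p \<and> p \<in> P \<and>
           ((\<exists>l<L (card P). \<exists>x\<in>P. \<forall>i<d. \<bar>x i - q i\<bar> \<le> u (card P) r \<omega> l i) \<longrightarrow>
            (\<exists>l<L (card P). \<forall>i<d. \<bar>p i - q i\<bar> \<le> D * u (card P) r \<omega> l i)))"
      for P and r :: real and \<omega> and m :: memory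
    \<comment> \<open>The properties in \<open>good\<close> can be met for every seed; only the link
      between the widths and the Orlicz norm is probabilistic.\<close>
    define pre where "pre P r \<omega> = (SOME m. good P r \<omega> m)" for P r \<omega>
    have pre: "good P r \<omega> (pre P r \<omega>)"
      if P: "P \<subseteq> points d" "finite P" "1 \<le> card P" and r: "0 < r" for P r \<omega>
    proof -
      have "\<exists>m. good P r \<omega> m"
        unfolding good_def D_def
        using P r d w(1) res(1)[OF P(3)]
        by (intro memory_exists[OF B_def P(1,2) refl _ _ _ rho J]) (auto simp: u_def)
      then show ?thesis unfolding pre_def by (rule someI_ex)
    qed
    show "\<exists>c prog pre (b::nat \<Rightarrow> nat).
         1 < c \<and> c \<le> 153 * (max 1 (ln (ln (real d))) / \<epsilon>\<^sup>2) \<and>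
         (\<forall>n\<ge>1.
            real (b n) \<le> K * log 2 (real d * real n + 1) \<and>
            ann_data_structure d (orlicz_norm d G) c n prog pre (b n)
              (K * (real d * real n powr (1 + \<epsilon>)))
              (K * (real d * real n powr \<epsilon>)))"
    proof (intro exI[of _ "D * \<kappa>"] exI[of _ "walk d"] exI[of _ pre] exI[of _ b] conjI allI impI)
      show "1 < D * \<kappa>" using D k less_1_mult[of D \<kappa>] by simp
      show "D * \<kappa> \<le> 153 * (max 1 (ln (ln (real d))) / \<epsilon>\<^sup>2)"
        unfolding D_def \<kappa>_def by (rule approximation_bound[OF eps d J_def[unfolded \<rho>_def]])
      fix n :: nat assume n: "1 \<le> n"
      show "real (b n) \<le> K * log 2 (real d * real n + 1)" by (rule res(4)[OF n])
      show "ann_data_structure d (orlicz_norm d G) (D * \<kappa>) n (walk d) pre (b n)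
          (K * (real d * real n powr (1 + \<epsilon>))) (K * (real d * real n powr \<epsilon>))"
        unfolding ann_data_structure_def
      proof (intro allI impI)
        fix P :: "(nat \<Rightarrow> real) set" and r :: real
        assume "P \<subseteq> points d \<and> finite P \<and> card P = n \<and> 0 < r"
        then have P: "P \<subseteq> points d" "finite P" "card P = n" and r: "0 < r" by auto
        have good: "good P r \<omega> (pre P r \<omega>)" for \<omega> using pre P n r by simp
        have m: "length (fst (pre P r \<omega>)) + length (snd (pre P r \<omega>)) \<le> 6 * B n + n * d"
            "\<forall>v\<in>set (fst (pre P r \<omega>)). v < 2 ^ b n" for \<omega>
          using good[of \<omega>] P(3) by (simp_all add: good_def)
        have ans: "\<exists>t p. real t \<le> K * (real d * real n powr \<epsilon>) \<and>
              answers (walk d) (b n) d (pre P r \<omega>) q t p \<and> p \<in> P \<and>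
              ((\<exists>l<L n. \<exists>x\<in>P. \<forall>i<d. \<bar>x i - q i\<bar> \<le> u n r \<omega> l i) \<longrightarrow>
               (\<exists>l<L n. \<forall>i<d. \<bar>p i - q i\<bar> \<le> D * u n r \<omega> l i))" for \<omega> q
        proof -
          obtain t p where tp: "real t \<le> 9 * (real (L n) * (6 * real d * (1 + ln n))) + 6"
              "answers (walk d) (b n) d (pre P r \<omega>) q t p" "p \<in> P"
              "(\<exists>l<L n. \<exists>x\<in>P. \<forall>i<d. \<bar>x i - q i\<bar> \<le> u n r \<omega> l i) \<longrightarrow>
               (\<exists>l<L n. \<forall>i<d. \<bar>p i - q i\<bar> \<le> D * u n r \<omega> l i)"
            using good[of \<omega>] unfolding good_def P(3) by blast
          show ?thesis
            using order_trans[OF tp(1) res(3)[OF n]] tp(2-4) by (intro exI[of _ t] exI[of _ p] conjI)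
        qed
        have "\<exists>A\<in>sets seeds. 2 / 3 \<le> measure seeds A \<and>
            (\<forall>\<omega>\<in>A. \<exists>t. \<exists>p'\<in>P. real t \<le> K * (real d * real n powr \<epsilon>) \<and>
              answers (walk d) (b n) d (pre P r \<omega>) q t p' \<and>
              orlicz_norm d G (\<lambda>i. p' i - q i) \<le> D * \<kappa> * r)"
          if near: "\<exists>p\<in>P. orlicz_norm d G (\<lambda>i. p i - q i) \<le> r" for q
        proof -
          obtain p where p: "p \<in> P" "orlicz_norm d G (\<lambda>i. p i - q i) \<le> r" using near by blast
          define x where "x i = (p i - q i) / r" for i
          have x: "(\<Sum>i<d. G \<bar>x i\<bar>) \<le> 1"
            using p(2) orlicz_norm_le_iff[OF G r] by (simp add: x_def orlicz_ball_def)
          define F where "F = {p \<in> P. D * \<kappa> * r < orlicz_norm d G (\<lambda>i. p i - q i)}"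
          \<comment> \<open>Differences are divided by \<open>D * r\<close> because a returned point
            lies within \<open>D\<close> times the widths; beyond \<open>D * \<kappa> * r\<close>
            the scaled norm still exceeds \<open>\<kappa>\<close>.\<close>
          define Y where "Y = (\<lambda>p i. (p i - q i) / (D * r)) ` F"
          have Y: "finite Y" "card Y \<le> n"
            using P card_image_le[of F] card_mono[of P F] by (auto simp: Y_def F_def intro: le_trans)
          have far: "\<forall>y\<in>Y. \<kappa> \<le> (\<Sum>i<d. G \<bar>y i\<bar>)"
          proof
            fix y assume y: "y \<in> Y"
            obtain p where "p \<in> P" "\<kappa> * (D * r) < orlicz_norm d G (\<lambda>i. p i - q i)"
              "y = (\<lambda>i. (p i - q i) / (D * r))" using y by (auto simp: Y_def F_def mult_ac)
            then show "\<kappa> \<le> (\<Sum>i<d. G \<bar>y i\<bar>)"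
              using orlicz_far[OF G, of "D * r" \<kappa> d "\<lambda>i. p i - q i"] D k r by simp
          qed
          have lam: "0 < lam n" using n eps by (simp add: lam_def)
          obtain A where A: "A \<in> sets seeds"
            "1 - (1 - exp (- lam n)) ^ L n - real (card Y) * real (L n) * exp (- lam n * \<kappa>)
               \<le> measure seeds A"
            "\<forall>\<omega>\<in>A. (\<forall>k. 0 < \<omega> k \<and> \<omega> k < 1) \<and>
               (\<exists>l<L n. \<forall>i<d. \<omega> (l * d + i) \<le> exp (- lam n * G \<bar>x i\<bar>)) \<and>
               (\<forall>l<L n. \<forall>y\<in>Y. \<not> (\<forall>i<d. \<omega> (l * d + i) \<le> exp (- lam n * G \<bar>y i\<bar>)))"
            using good_seeds[OF G lam x Y(1) far, where L = "L n"] by (elim bexE conjE)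
          have "0 < \<epsilon> / 2" "1 + 1 / (\<epsilon> / 2) = \<kappa>" using eps by (simp_all add: \<kappa>_def)
          then have "2 / 3 \<le> measure seeds A"
            using order_trans[OF failure_bound[OF _ n lam_def L_def Y(2)]] A(2) by presburger
          moreover have "\<exists>t. \<exists>p'\<in>P. real t \<le> K * (real d * real n powr \<epsilon>) \<and>
              answers (walk d) (b n) d (pre P r \<omega>) q t p' \<and>
              orlicz_norm d G (\<lambda>i. p' i - q i) \<le> D * \<kappa> * r" if om: "\<omega> \<in> A" for \<omega>
          proof -
            have width: "\<bar>z / s\<bar> \<le> w n (\<omega> j) \<longleftrightarrow> \<omega> j \<le> exp (- lam n * G \<bar>z / s\<bar>)" for z s j
              using w(2)[OF n, of "\<omega> j"] A(3) om by simp
            obtain l where l: "l < L n" "\<forall>i<d. \<omega> (l * d + i) \<le> exp (- lam n * G \<bar>x i\<bar>)"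
              using A(3) om by blast
            have "\<bar>p i - q i\<bar> \<le> u n r \<omega> l i" if "i < d" for i
            proof -
              have "\<bar>(p i - q i) / r\<bar> \<le> w n (\<omega> (l * d + i))" using l(2) that by (simp only: width x_def)
              then show ?thesis using r by (simp add: u_def abs_divide pos_divide_le_eq mult.commute)
            qed
            then have "\<exists>l<L n. \<exists>x\<in>P. \<forall>i<d. \<bar>x i - q i\<bar> \<le> u n r \<omega> l i" using p(1) l(1) by blast
            then obtain t p' where t: "real t \<le> K * (real d * real n powr \<epsilon>)"
              "answers (walk d) (b n) d (pre P r \<omega>) q t p'" "p' \<in> P"
              "\<exists>l<L n. \<forall>i<d. \<bar>p' i - q i\<bar> \<le> D * u n r \<omega> l i"
              using ans[of \<omega> q] by blast
            then obtain l where l: "l < L n" "\<forall>i<d. \<bar>p' i - q i\<bar> \<le> D * u n r \<omega> l i" by blast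
            \<comment> \<open>A far answer, scaled by \<open>D * r\<close>, would be captured by
              sample \<open>l\<close>, which the event \<open>A\<close> excludes.\<close>
            have "p' \<notin> F"
            proof
              assume "p' \<in> F"
              then have Y: "(\<lambda>i. (p' i - q i) / (D * r)) \<in> Y" by (simp add: Y_def)
              have hit: "\<omega> (l * d + i) \<le> exp (- lam n * G \<bar>(p' i - q i) / (D * r)\<bar>)" if "i < d" for i
              proof -
                have "\<bar>p' i - q i\<bar> \<le> w n (\<omega> (l * d + i)) * (D * r)"
                  using l(2) that by (simp add: u_def mult_ac)
                then have "\<bar>(p' i - q i) / (D * r)\<bar> \<le> w n (\<omega> (l * d + i))"
                  using D r by (simp add: abs_divide abs_mult pos_divide_le_eq)
                then show ?thesis by (simp only: width)
              qed
              have "\<forall>y\<in>Y. \<not> (\<forall>i<d. \<omega> (l * d + i) \<le> exp (- lam n * G \<bar>y i\<bar>))"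
                using conjunct2[OF conjunct2[OF bspec[OF A(3) om]]] l(1) by blast
              from bspec[OF this Y] show False using hit by blast
            qed
            then show ?thesis using t by (auto simp: F_def not_less)
          qed
          ultimately show ?thesis using A(1) by blast
        qed
        moreover have "real (length (fst (pre P r \<omega>)) + length (snd (pre P r \<omega>)) + length (walk d))
            \<le> K * (real d * real n powr (1 + \<epsilon>))" for \<omega>
          using m(1)[of \<omega>] res(2)[OF n] by (simp add: walk_def)
        ultimately show "(\<forall>\<omega>\<in>space seeds.
             real (length (fst (pre P r \<omega>)) + length (snd (pre P r \<omega>)) + length (walk d))
               \<le> K * (real d * real n powr (1 + \<epsilon>)) \<and>
             (\<forall>v\<in>set (fst (pre P r \<omega>)). v < 2 ^ b n) \<and>
             (\<forall>q\<in>points d. \<exists>t p. real t \<le> K * (real d * real n powr \<epsilon>) \<and>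
                answers (walk d) (b n) d (pre P r \<omega>) q t p)) \<and>
          (\<forall>q\<in>points d. (\<exists>p\<in>P. orlicz_norm d G (\<lambda>i. p i - q i) \<le> r) \<longrightarrow>
             (\<exists>A\<in>sets seeds. 2 / 3 \<le> measure seeds A \<and>
                (\<forall>\<omega>\<in>A. \<exists>t. \<exists>p'\<in>P. real t \<le> K * (real d * real n powr \<epsilon>) \<and>
                   answers (walk d) (b n) d (pre P r \<omega>) q t p' \<and>
                   orlicz_norm d G (\<lambda>i. p' i - q i) \<le> D * \<kappa> * r)))"
          using m(2) ans by meson
      qed
    qed
  qed
qed simp

end
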